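(* Let $\mathbb{F}$ be a field of positive characteristic, and let $R$ be an associative $\mathbb{F}$-algebra with $R=R_1+R_2$, where $R_1,R_2$ are subalgebras of $R$ that are PI-algebras. Assume that there exist a two-sided ideal $I_1$ of $R_1$ of finite codimension in $R_1$, a two-sided ideal $I_2$ of $R_2$ of finite codimension in $R_2$, and an integer $k>0$ such that $(I_1I_2)^k\subset I_1$ or $(I_1I_2)^k\subset I_2$. Then $R$ is a PI-algebra.
   Context: Algebras are associative and need not have a unity. $R=R_1+R_2$ means that every element of $R$ is of the form $r_1+r_2$ with $r_1\in R_1$, $r_2\in R_2$ (the sum need not be direct). Let $\mathbb{F}\langle X\rangle$ be the free associative $\mathbb{F}$-algebra without unity on $x_1,x_2,\ldots$, i.e. the vector space with basis all non-empty words in $x_1,x_2,\ldots$. A polynomial identity of an $\mathbb{F}$-algebra $A$ is a non-zero $f(x_1,\ldots,x_n)\in\mathbb{F}\langle X\rangle$ with $f(a_1,\ldots,a_n)=0$ for all $a_1,\ldots,a_n\in A$. A PI-algebra is an algebra that satisfies some polynomial identity. For subsets $A,B$ of an algebra, $(AB)^k$ denotes the set of all products $a_1b_1a_2b_2\cdots a_kb_k$ with $a_j\in A$, $b_j\in B$. *)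

theory Defs
  imports Complex_Main "HOL-Library.Poly_Mapping"
begin

text \<open>The class \<open>ring\<close> does not require a unity.\<close>

locale assoc_algebra = vector_space scale
  for scale :: "'f::field \<Rightarrow> 'a::ring \<Rightarrow> 'a"  (infixr \<open>*s\<close> 75) +
  assumes scale_mult_left: "(c *s x) * y = c *s (x * y)"
    and scale_mult_right: "x * (c *s y) = c *s (x * y)"

text \<open>The product of a non-empty list. It is left unspecified on the empty list, since there
  is no unity.\<close>

fun list_product :: "'a::semigroup_mult list \<Rightarrow> 'a" where
  "list_product (x # xs) = foldl (*) x xs"

text \<open>The underlying vector space of the free associative algebra without unity on variables
  indexed by \<^typ>\<open>nat\<close>: a word is a list of indices, and a polynomial is a finitely supported
  coefficient function that vanishes on the empty word.\<close>

definition free_algebra :: "(nat list \<Rightarrow>\<^sub>0 'f::zero) set" where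
  "free_algebra = {f. [] \<notin> Poly_Mapping.keys f}"

text \<open>The set \<open>(AB)\<^sup>k\<close> of all products \<open>a\<^sub>1b\<^sub>1\<dots>a\<^sub>kb\<^sub>k\<close>; only meaningful for \<open>k > 0\<close>.\<close>

definition alternating_products :: "'a::semigroup_mult set \<Rightarrow> 'a set \<Rightarrow> nat \<Rightarrow> 'a set" where
  "alternating_products A B k =
     {list_product (map2 (*) as bs) | as bs.
        length as = k \<and> length bs = k \<and> set as \<subseteq> A \<and> set bs \<subseteq> B}"

context assoc_algebra
begin

definition subalgebra :: "'a set \<Rightarrow> bool" where
  "subalgebra S \<longleftrightarrow> subspace S \<and> (\<forall>x\<in>S. \<forall>y\<in>S. x * y \<in> S)"

definition two_sided_ideal :: "'a set \<Rightarrow> 'a set \<Rightarrow> bool" where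
  "two_sided_ideal I S \<longleftrightarrow>
     subspace I \<and> I \<subseteq> S \<and> (\<forall>s\<in>S. \<forall>x\<in>I. s * x \<in> I \<and> x * s \<in> I)"

text \<open>\<open>S/I\<close> is spanned by the cosets of the elements of a finite set \<open>B \<subseteq> S\<close>.\<close>

definition finite_codim :: "'a set \<Rightarrow> 'a set \<Rightarrow> bool" where
  "finite_codim I S \<longleftrightarrow>
     (\<exists>B. finite B \<and> B \<subseteq> S \<and> (\<forall>s\<in>S. \<exists>b\<in>span B. s - b \<in> I))"

definition eval_poly :: "(nat \<Rightarrow> 'a) \<Rightarrow> (nat list \<Rightarrow>\<^sub>0 'f) \<Rightarrow> 'a" where
  "eval_poly a f =
     (\<Sum>w\<in>Poly_Mapping.keys f. Poly_Mapping.lookup f w *s list_product (map a w))"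

text \<open>Substituting a whole sequence of elements of \<open>S\<close> agrees with substituting for the finitely
  many variables that occur in \<open>f\<close>, as long as \<open>S\<close> is non-empty.\<close>

definition polynomial_identity :: "(nat list \<Rightarrow>\<^sub>0 'f) \<Rightarrow> 'a set \<Rightarrow> bool" where
  "polynomial_identity f S \<longleftrightarrow>
     f \<in> free_algebra \<and> f \<noteq> 0 \<and> (\<forall>a. (\<forall>i. a i \<in> S) \<longrightarrow> eval_poly a f = 0)"

definition PI_algebra :: "'a set \<Rightarrow> bool" where
  "PI_algebra S \<longleftrightarrow> (\<exists>f. polynomial_identity f S)"

end

end

(*
  Write A = I1, B = I2, so that R = A + B + span E with E finite, and let (AB)^k be contained in A
  (the other case follows by passing to the opposite algebra). We look for a multilinear identity of
  large degree n. By linearity it suffices that it vanishes when each variable is assigned a type,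
  that is, takes values in A, in B, or equals a fixed element of E.

  For a fixed type assignment, order the n! multilinear words lexicographically. Two A-letters of a
  word with the same number of E-letters and the same number modulo k of BA-passages before them
  delimit a segment with values in A, and two B-letters in the same run of B-letters delimit a
  segment with values in B. Hence, as in the proofs of Shirshov and Latyshev, a word with a long
  decreasing sequence of letters in one such cell is a combination of smaller words, by the
  multilinear identities of A and B. The remaining words are determined by labels of their positions
  and letters, and for large n the total number of labellings over all type assignments is less than
  n!. So the linear conditions on the n! coefficients of the identity have a nonzero solution.
*)

theory Submission
  imports Defs "HOL-Combinatorics.Multiset_Permutations"
begin

subsection \<open>Multilinear identities\<close>

text \<open>Products are formed with an explicit multiplication \<open>m\<close>, so that the argument also applies
  to the opposite algebra: reversing the multiplication exchanges the two cases of the theorem.\<close>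

fun mprod :: "('a \<Rightarrow> 'a \<Rightarrow> 'a) \<Rightarrow> 'a list \<Rightarrow> 'a" where
  "mprod m (x # xs) = foldl m x xs"

text \<open>The index is shifted by one: \<open>alternating m A B c\<close> is $(AB)^{c+1}$.\<close>

fun alternating :: "('a \<Rightarrow> 'a \<Rightarrow> 'a) \<Rightarrow> 'a set \<Rightarrow> 'a set \<Rightarrow> nat \<Rightarrow> 'a set" where
  "alternating m A B 0 = {m a b | a b. a \<in> A \<and> b \<in> B}"
| "alternating m A B (Suc c) = {m x (m a b) | x a b. x \<in> alternating m A B c \<and> a \<in> A \<and> b \<in> B}"

locale bilinear_algebra = vector_space scale
  for scale :: "'f::field \<Rightarrow> 'a::ab_group_add \<Rightarrow> 'a"  (infixr \<open>*s\<close> 75) +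
  fixes m :: "'a \<Rightarrow> 'a \<Rightarrow> 'a"  (infixl \<open>\<star>\<close> 70)
  assumes assoc: "(x \<star> y) \<star> z = x \<star> (y \<star> z)"
    and add_left: "(x + y) \<star> z = x \<star> z + y \<star> z"
    and add_right: "x \<star> (y + z) = x \<star> y + x \<star> z"
    and scale_left: "(c *s x) \<star> y = c *s (x \<star> y)"
    and scale_right: "x \<star> (c *s y) = c *s (x \<star> y)"
begin

abbreviation prd :: "'a list \<Rightarrow> 'a" where "prd \<equiv> mprod m"

text \<open>A polynomial is given by its finite support \<open>K\<close> and its coefficients there,
  so that the notion makes sense for any multiplication \<open>m\<close>. The empty word is excluded
  since \<open>mprod\<close> is unspecified on it.\<close>

definition satisfies_identity :: "'a set \<Rightarrow> bool" where
  "satisfies_identity S \<longleftrightarrow> (\<exists>K f. finite K \<and> K \<noteq> {} \<and> [] \<notin> K \<and> (\<forall>w\<in>K. f w \<noteq> 0) \<and>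
     (\<forall>a :: nat \<Rightarrow> 'a. range a \<subseteq> S \<longrightarrow> (\<Sum>w\<in>K. f w *s prd (map a w)) = 0))"

text \<open>The coefficient of the increasing word is required to be non-zero: in the applications
  this word stands for the word to be rewritten, and the identity is solved for it.\<close>

definition multilinear_identity :: "nat \<Rightarrow> (nat list \<Rightarrow> 'f) \<Rightarrow> 'a set \<Rightarrow> bool" where
  "multilinear_identity d c S \<longleftrightarrow> d > 0 \<and> c [0..<d] \<noteq> 0 \<and>
     (\<forall>y. (\<forall>i<d. y i \<in> S) \<longrightarrow> (\<Sum>w\<in>permutations_of_set {..<d}. c w *s prd (map y w)) = 0)"

definition mult_closed :: "'a set \<Rightarrow> bool" where
  "mult_closed S \<longleftrightarrow> (\<forall>x\<in>S. \<forall>y\<in>S. x \<star> y \<in> S)"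

lemma prd_Cons: "xs \<noteq> [] \<Longrightarrow> prd (x # xs) = x \<star> prd xs"
proof -
  have "foldl m (x \<star> y) ys = x \<star> foldl m y ys" for y ys
    by (induction ys arbitrary: y) (simp_all add: assoc)
  then show "xs \<noteq> [] \<Longrightarrow> ?thesis" by (cases xs) simp_all
qed

lemma prd_append: "xs \<noteq> [] \<Longrightarrow> ys \<noteq> [] \<Longrightarrow> prd (xs @ ys) = prd xs \<star> prd ys"
proof (induction xs)
  case (Cons x xs)
  then show ?case by (cases "xs = []") (simp_all add: prd_Cons assoc del: mprod.simps, simp)
qed simp

lemma prd_concat:
  assumes "us \<noteq> []" and "\<And>u. u \<in> set us \<Longrightarrow> u \<noteq> []"
  shows "prd (concat us) = prd (map prd us)"
  using assms
proof (induction us)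
  case (Cons u us)
  then show ?case
    by (cases "us = []") (simp_all add: prd_Cons prd_append del: mprod.simps, simp)
qed simp

lemma zero_left: "0 \<star> x = 0"
  using add_left[of 0 0 x] by simp

lemma zero_right: "x \<star> 0 = 0"
  using add_right[of x 0 0] by simp

lemma sum_left: "sum g I \<star> x = (\<Sum>i\<in>I. g i \<star> x)"
  by (induction I rule: infinite_finite_induct) (simp_all add: zero_left add_left)

lemma sum_right: "x \<star> sum g I = (\<Sum>i\<in>I. x \<star> g i)"
  by (induction I rule: infinite_finite_induct) (simp_all add: zero_right add_right)

lemma
  shows prd_slot_add: "prd (xs @ (x + y) # ys) = prd (xs @ x # ys) + prd (xs @ y # ys)"
    and prd_slot_scale: "prd (xs @ (c *s x) # ys) = c *s prd (xs @ x # ys)"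
  by (cases "xs = []"; cases "ys = []";
      simp add: prd_append prd_Cons add_left add_right scale_left scale_right del: mprod.simps;
      simp add: add_left add_right scale_left scale_right)+

lemma prd_context_sum:
  "prd (us @ [\<Sum>i\<in>I. c i *s x i] @ vs) = (\<Sum>i\<in>I. c i *s prd (us @ [x i] @ vs))"
proof -
  have zero: "prd (us @ 0 # vs) = 0"
    using prd_slot_scale[of us 0 0 vs] by simp
  show ?thesis
    by (induction I rule: infinite_finite_induct)
      (simp_all add: zero prd_slot_add prd_slot_scale)
qed

text \<open>Distributivity: expanding the product chooses for each letter of \<open>v\<close> one
  index in its fibre under \<open>g\<close>.\<close>

lemma prd_map_sum:
  assumes "finite J" and "v \<noteq> []"
  shows "prd (map (\<lambda>i. \<Sum>j\<in>{j\<in>J. g j = i}. y j) v) =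
    (\<Sum>js\<in>{js. set js \<subseteq> J \<and> map g js = v}. prd (map y js))"
  using assms(2)
proof (induction v rule: list_nonempty_induct)
  case (single x)
  have "{js. set js \<subseteq> J \<and> map g js = [x]} = (\<lambda>j. [j]) ` {j\<in>J. g j = x}"
    by auto
  then show ?case by (simp add: sum.reindex inj_on_def)
next
  case (cons x v)
  let ?A = "{j\<in>J. g j = x}" and ?B = "{js. set js \<subseteq> J \<and> map g js = v}"
  have ne: "js \<noteq> []" if "js \<in> ?B" for js using that cons(1) by auto
  have set_eq: "{js. set js \<subseteq> J \<and> map g js = x # v} = (\<lambda>(j, js). j # js) ` (?A \<times> ?B)"
    by (auto simp: image_iff)
  have "prd (map (\<lambda>i. \<Sum>j\<in>{j\<in>J. g j = i}. y j) (x # v)) = sum y ?A \<star> (\<Sum>js\<in>?B. prd (map y js))"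
    using cons by (simp add: prd_Cons del: mprod.simps)
  also have "\<dots> = (\<Sum>j\<in>?A. \<Sum>js\<in>?B. y j \<star> prd (map y js))"
    by (simp only: sum_left) (simp only: sum_right)
  also have "\<dots> = (\<Sum>j\<in>?A. \<Sum>js\<in>?B. prd (map y (j # js)))"
    by (intro sum.cong refl) (simp add: prd_Cons ne del: mprod.simps)
  also have "\<dots> = (\<Sum>js\<in>{js. set js \<subseteq> J \<and> map g js = x # v}. prd (map y js))"
    unfolding set_eq by (subst sum.reindex) (auto simp: inj_on_def sum.cartesian_product split_def)
  finally show ?case .
qed

text \<open>Let \<open>w0\<close> be a word of maximal length \<open>d\<close> in the identity, and substitute for each variable \<open>i\<close> the
  sum of the new variables at the positions of \<open>i\<close> in \<open>w0\<close>. The part of the result in which every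
  new variable occurs is multilinear because \<open>d\<close> is maximal, and it vanishes by inclusion-exclusion
  over the sets \<open>J\<close> of new variables that are not set to zero; homogeneous components, which
  would need an infinite field, are avoided.\<close>

lemma multilinear_identity_exists:
  assumes "satisfies_identity S" and "subspace S"
  obtains d c where "multilinear_identity d c S"
proof -
  from assms(1) obtain K f where K: "finite K" "K \<noteq> {}" "[] \<notin> K" "\<forall>w\<in>K. f w \<noteq> 0"
    and id: "\<And>a :: nat \<Rightarrow> 'a. range a \<subseteq> S \<Longrightarrow> (\<Sum>w\<in>K. f w *s prd (map a w)) = 0"
    unfolding satisfies_identity_def by blast
  have "Max (length ` K) \<in> length ` K" using K(1,2) by simp
  then obtain w0 where w0: "w0 \<in> K" "\<And>w. w \<in> K \<Longrightarrow> length w \<le> length w0"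
  proof
    fix w assume "w \<in> K" "Max (length ` K) = length w"
    then show thesis using that[of w] K(1) by (metis Max_ge finite_imageI imageI)
  qed
  define d where "d = length w0"
  define g where "g = (!) w0"
  define c where "c js = (if map g js \<in> K then f (map g js) else 0)" for js
  have "d > 0" using w0(1) K(3) by (cases w0) (auto simp: d_def)
  moreover have "map g [0..<d] = w0" by (simp add: g_def d_def map_nth)
  then have "c [0..<d] \<noteq> 0" using w0(1) K(4) by (simp add: c_def)
  moreover have "(\<Sum>w\<in>permutations_of_set {..<d}. c w *s prd (map y w)) = 0"
    if y: "\<forall>i<d. y i \<in> S" for y
  proof -
    let ?F = "\<lambda>js. f (map g js) *s prd (map y js)"
    \<comment> \<open>Among the lifts of words of \<open>K\<close>, \<open>?L J\<close> collects
      those that use only variables from \<open>J\<close>, and \<open>?H J\<close> sums over those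
      that use all of them.\<close>
    let ?L = "\<lambda>J. {js. set js \<subseteq> J \<and> map g js \<in> K}"
    let ?H = "\<lambda>J. sum ?F {js. set js = J \<and> map g js \<in> K}"
    have fin: "finite (?L J)" if "finite J" for J
    proof (rule finite_subset)
      show "?L J \<subseteq> {js. set js \<subseteq> J \<and> length js \<le> d}"
        using w0(2) by (fastforce simp: d_def)
      show "finite {js. set js \<subseteq> J \<and> length js \<le> d}"
        using that by (rule finite_lists_length_le)
    qed
    have L0: "sum ?F (?L J) = 0" if J: "J \<subseteq> {..<d}" for J
    proof -
      have "finite J" using J finite_subset by blast
      let ?a = "\<lambda>i. \<Sum>j\<in>{j\<in>J. g j = i}. y j"
      have "range ?a \<subseteq> S"
        using J y by (auto intro!: subspace_sum[OF assms(2)])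
      then have "0 = (\<Sum>v\<in>K. f v *s prd (map ?a v))" using id by simp
      also have "\<dots> = (\<Sum>v\<in>K. \<Sum>js\<in>{js\<in>?L J. map g js = v}. ?F js)"
      proof (intro sum.cong refl)
        fix v assume v: "v \<in> K"
        then have "v \<noteq> []" using K(3) by auto
        have "{js\<in>?L J. map g js = v} = {js. set js \<subseteq> J \<and> map g js = v}"
          using v by auto
        then show "f v *s prd (map ?a v) = (\<Sum>js\<in>{js\<in>?L J. map g js = v}. ?F js)"
          by (simp add: prd_map_sum[OF \<open>finite J\<close> \<open>v \<noteq> []\<close>] scale_sum_right)
      qed
      also have "\<dots> = sum ?F (?L J)"
        by (rule sum.group) (use fin \<open>finite J\<close> K(1) in auto)
      finally show ?thesis by simp
    qed
    have H0: "?H J = 0" if "J \<subseteq> {..<d}" for J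
    proof -
      have "finite J" using that finite_subset by blast
      then show ?thesis using that
      proof (induction J rule: finite_psubset_induct)
        case (psubset J)
        have "0 = sum ?F (?L J)" using L0 psubset.prems by simp
        also have "\<dots> = (\<Sum>J'\<in>Pow J. sum ?F {js \<in> ?L J. set js = J'})"
          by (rule sum.group[symmetric]) (use fin psubset.hyps in auto)
        also have "\<dots> = (\<Sum>J'\<in>Pow J. ?H J')"
          by (intro sum.cong refl) auto
        also have "\<dots> = ?H J + (\<Sum>J'\<in>Pow J - {J}. ?H J')"
          using psubset.hyps by (intro sum.remove) auto
        also have "(\<Sum>J'\<in>Pow J - {J}. ?H J') = 0"
          using psubset by (intro sum.neutral) auto
        finally show ?case by simp
      qed
    qed
    have "(\<Sum>w\<in>permutations_of_set {..<d}. c w *s prd (map y w)) =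
        (\<Sum>w\<in>{w\<in>permutations_of_set {..<d}. map g w \<in> K}. ?F w)"
      by (rule sum.mono_neutral_cong_right) (auto simp: c_def)
    also have "{w\<in>permutations_of_set {..<d}. map g w \<in> K} = {js. set js = {..<d} \<and> map g js \<in> K}"
    proof -
      \<comment> \<open>A word of length at most \<open>d\<close> that contains all \<open>d\<close>
        variables contains each of them once.\<close>
      have "distinct js" if "set js = {..<d}" "map g js \<in> K" for js
        using w0(2)[OF that(2)] that(1) card_length[of js]
        by (intro card_distinct) (simp add: d_def)
      then show ?thesis by (auto simp: permutations_of_set_def)
    qed
    finally show ?thesis using H0[of "{..<d}"] by simp
  qed
  ultimately show ?thesis using that unfolding multilinear_identity_def by blast
qed

end

subsection \<open>Combinatorics of words\<close>

text \<open>At the first place where the two lists of blocks differ, the block of \<open>vs\<close>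
  occurs later in \<open>us\<close> and so has the smaller head. Rearranging blocks keeps the total
  length, as \<open>lex\<close> requires.\<close>

lemma concat_permuted_lex:
  fixes us :: "'b::linorder list list"
  assumes "mset vs = mset us" and "\<forall>u\<in>set us. u \<noteq> []"
    and "sorted_wrt (\<lambda>u v. hd u > hd v) us" and "vs \<noteq> us"
  shows "(concat vs, concat us) \<in> lex {(x, y). x < y}"
  using assms
proof (induction us arbitrary: vs)
  case (Cons u us)
  then obtain v vs' where vs: "vs = v # vs'" by (cases vs) auto
  show ?case
  proof (cases "v = u")
    case True
    then show ?thesis using Cons vs by (auto intro!: lex_append_leftI)
  next
    case False
    have "v \<in> set us" using Cons.prems(1) False vs
      by (metis list.set_intros(1) mset_eq_setD set_ConsD)
    then have "hd v < hd u" "v \<noteq> []" "u \<noteq> []" using Cons.prems by auto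
    then obtain x xs y ys where "v = x # xs" "u = y # ys" "x < y"
      by (cases v; cases u) auto
    moreover have "length (concat vs) = length (concat (u # us))"
      using arg_cong[OF Cons.prems(1), of "\<lambda>M. sum_mset (image_mset length M)"]
      unfolding length_concat by (simp flip: sum_mset_sum_list)
    ultimately show ?thesis using vs by (auto simp: Cons_in_lex)
  qed
qed simp

text \<open>The minimal elements form one colour class; removing them shortens every chain.\<close>

lemma chain_free_colouring:
  assumes "\<And>ps. length ps = Suc d \<Longrightarrow> set ps \<subseteq> P \<Longrightarrow> \<not> successively R ps"
  shows "\<exists>col. (\<forall>p\<in>P. col p < d) \<and> (\<forall>p\<in>P. \<forall>q\<in>P. R p q \<longrightarrow> col p \<noteq> col q)"
  using assms
proof (induction d arbitrary: P)
  case 0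
  have "P = {}" using 0[of "[x]" for x] by auto
  then show ?case by simp
next
  case (Suc d)
  define M where "M = {x\<in>P. \<forall>y\<in>P. \<not> R y x}"
  have "\<not> successively R ps" if ps: "length ps = Suc d" "set ps \<subseteq> P - M" for ps
  proof
    assume succ: "successively R ps"
    obtain x xs where x: "ps = x # xs" using ps by (cases ps) auto
    \<comment> \<open>The head of the chain is not minimal, so the chain can be prolonged to the
      left inside \<open>P\<close>.\<close>
    then obtain y where "y \<in> P" "R y x" using ps by (auto simp: M_def)
    then show False using Suc.prems[of "y # ps"] ps x succ by auto
  qed
  from Suc.IH[OF this] obtain col where col: "\<forall>p\<in>P - M. col p < d"
    "\<forall>p\<in>P - M. \<forall>q\<in>P - M. R p q \<longrightarrow> col p \<noteq> col q"
    by blast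
  define col' where "col' p = (if p \<in> M then d else col p)" for p
  have "\<forall>p\<in>P. \<forall>q\<in>P. R p q \<longrightarrow> col' p \<noteq> col' q"
    using col unfolding col'_def by (metis (no_types, lifting) DiffI M_def less_irrefl mem_Collect_eq)
  moreover have "\<forall>p\<in>P. col' p < Suc d"
    using col by (auto simp: col'_def less_Suc_eq)
  ultimately show ?case by blast
qed

section \<open>Homogeneous linear systems with more unknowns than equations\<close>

lemma underdetermined_system:
  fixes M :: "'e \<Rightarrow> 'w \<Rightarrow> 'f::field"
  assumes "finite E" and "finite W" and "card E < card W"
  shows "\<exists>c. (\<exists>w\<in>W. c w \<noteq> 0) \<and> (\<forall>e\<in>E. (\<Sum>w\<in>W. c w * M e w) = 0)"
  using assms
proof (induction E arbitrary: W M rule: finite_induct)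
  case empty
  then have "W \<noteq> {}" by auto
  then show ?case by (intro exI[of _ "\<lambda>_. 1"]) auto
next
  case (insert e E)
  show ?case
  proof (cases "\<forall>w\<in>W. M e w = 0")
    case True
    from insert.prems insert.hyps have "card E < card W" by simp
    from insert.IH[OF insert.prems(1) this, of M] obtain c
      where "\<exists>w\<in>W. c w \<noteq> 0" "\<forall>e\<in>E. (\<Sum>w\<in>W. c w * M e w) = 0"
      by blast
    with True show ?thesis by (intro exI[of _ c]) simp
  next
    \<comment> \<open>Gaussian elimination: the pivot \<open>v\<close> is removed from the other
      equations by subtracting multiples of equation \<open>e\<close>.\<close>
    case False
    then obtain v where v: "v \<in> W" "M e v \<noteq> 0" by blast
    let ?W = "W - {v}"
    have "card E < card ?W" using insert v by simp
    from insert.IH[OF _ this, of "\<lambda>e' w. M e' w - M e' v * M e w / M e v"] insert.prems(1)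
    obtain c where c: "\<exists>w\<in>?W. c w \<noteq> 0"
      "\<forall>e'\<in>E. (\<Sum>w\<in>?W. c w * (M e' w - M e' v * M e w / M e v)) = 0"
      by auto
    \<comment> \<open>\<open>- s\<close> is the value that equation \<open>e\<close> forces on the
      unknown \<open>v\<close>.\<close>
    define s where "s = (\<Sum>w\<in>?W. c w * M e w) / M e v"
    have split: "(\<Sum>w\<in>W. (c(v := - s)) w * M e' w) = - s * M e' v + (\<Sum>w\<in>?W. c w * M e' w)" for e'
    proof -
      have "(\<Sum>w\<in>?W. (c(v := - s)) w * M e' w) = (\<Sum>w\<in>?W. c w * M e' w)"
        by (intro sum.cong) auto
      then show ?thesis using sum.remove[OF insert.prems(1) v(1), of "\<lambda>w. (c(v := - s)) w * M e' w"]
        by simp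
    qed
    have "(\<Sum>w\<in>W. (c(v := - s)) w * M e' w) = 0" if "e' \<in> E" for e'
    proof -
      have "0 = (\<Sum>w\<in>?W. c w * M e' w - M e' v / M e v * (c w * M e w))"
        using bspec[OF c(2) that] by (subst (asm) sum.cong[OF refl]) (simp_all add: right_diff_distrib mult_ac)
      also have "\<dots> = (\<Sum>w\<in>?W. c w * M e' w) - s * M e' v"
        by (simp only: sum_subtractf sum_distrib_left[symmetric]) (simp add: s_def)
      finally show ?thesis unfolding split by simp
    qed
    moreover have "(\<Sum>w\<in>W. (c(v := - s)) w * M e w) = 0"
      unfolding split using v(2) by (simp add: s_def)
    moreover have "\<exists>w\<in>W. (c(v := - s)) w \<noteq> 0" using c(1) by auto
    ultimately show ?thesis by blast
  qed
qed

section \<open>Label counts against the factorial\<close>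

lemma power_le_fact: "n ^ n \<le> 3 ^ n * fact n"
proof -
  \<comment> \<open>The left side is a single term of the exponential series at
    \<open>n\<close>.\<close>
  have "real n ^ n / fact n \<le> exp (real n)"
  proof -
    have "(\<Sum>k\<in>{n}. real n ^ k /\<^sub>R fact k) \<le> suminf (\<lambda>k. real n ^ k /\<^sub>R fact k)"
      by (intro sum_le_suminf summable_exp_generic) auto
    then show ?thesis by (simp add: exp_def divide_inverse_commute)
  qed
  also have "\<dots> \<le> 3 ^ n"
    using power_mono[OF exp_le, of n] by (simp flip: exp_of_nat_mult)
  finally have "real (n ^ n) \<le> real (3 ^ n * fact n)"
    by (simp add: field_simps)
  then show ?thesis by (simp only: of_nat_le_iff)
qed

text \<open>The base \<open>C\<close> is beaten in each of three ranges: if \<open>a + s\<close> is a small fraction of \<open>n\<close>, then most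
  letters are counted by \<open>b\<close> and their base \<open>a + s + 1\<close> is small against \<open>n\<close>; if \<open>s\<close> is much smaller than
  \<open>a + s\<close>, then \<open>a\<close> is a fixed fraction of \<open>n\<close> with small base \<open>s + 1\<close>; otherwise the missing
  factor \<open>n ^ s\<close> exceeds \<open>C ^ n\<close>.\<close>

lemma label_count_less_fact:
  fixes C :: nat
  obtains n where "\<And>s a b. s + a + b = n \<Longrightarrow> C ^ n * (Suc s ^ a * Suc (a + s) ^ b) < fact n"
proof -
  \<comment> \<open>\<open>D\<close> exceeds \<open>3 * C\<close>, where the 3 comes from
    \<open>power_le_fact\<close>. Each later constant absorbs the power of \<open>D\<close> that
    arises in its range: \<open>K\<close> takes \<open>D ^ 2\<close>, since there
    \<open>n \<le> 2 * b\<close>; \<open>L\<close> takes \<open>D ^ (4 * K)\<close>, since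
    \<open>n \<le> 4 * K * a\<close>; and \<open>n\<close> takes \<open>D ^ (4 * L)\<close>, since
    \<open>n \<le> 4 * L * s\<close>.\<close>
  define D where "D = 3 * C + 2"
  define K where "K = D ^ 2 + 1"
  define L where "L = D ^ (4 * K) + 2 * K"
  define n where "n = D ^ (4 * L) + 4 * L + 4 * K"
  have D: "D \<ge> 2" by (simp add: D_def)
  have K: "K \<ge> 5" using power_mono[OF D, of 2] by (simp add: K_def)
  have L: "L \<ge> 2 * K" "L > 0" using K by (auto simp: L_def)
  have n: "n \<ge> 4 * K" "n \<ge> 4 * L" "n > 0" using K by (auto simp: n_def)
  have main: "D ^ n * (Suc s ^ a * Suc (a + s) ^ b) \<le> n ^ n" if sab: "s + a + b = n" for s a b
  proof -
    have sa: "Suc s ^ a \<le> n ^ a" using sab by (cases "a = 0") (auto intro!: power_mono)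
    have asb: "Suc (a + s) ^ b \<le> n ^ b" using sab by (cases "b = 0") (auto intro!: power_mono)
    have ab: "n ^ (a + b) \<le> n ^ n" using sab n by (intro power_increasing) auto
    consider (1) "K * Suc (a + s) \<le> n" | (2) "K * Suc (a + s) > n" "L * Suc s \<le> n"
      | (3) "L * Suc s > n"
      by linarith
    then show ?thesis
    proof cases
      case 1
      have "5 * Suc (a + s) \<le> n" using 1 K by (meson le_trans mult_le_mono1)
      then have "n \<le> 2 * b" using sab by simp
      then have "D ^ n \<le> (D ^ 2) ^ b" using D by (simp flip: power_mult)
      also have "\<dots> \<le> K ^ b" by (intro power_mono) (auto simp: K_def)
      finally have "D ^ n * (Suc s ^ a * Suc (a + s) ^ b) \<le> K ^ b * (n ^ a * Suc (a + s) ^ b)"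
        using sa by (intro mult_mono) auto
      also have "\<dots> = n ^ a * (K * Suc (a + s)) ^ b" by (simp only: power_mult_distrib mult_ac)
      also have "\<dots> \<le> n ^ a * n ^ b" using 1 by (intro mult_mono power_mono) auto
      finally show ?thesis using ab by (simp add: power_add)
    next
      case 2
      have "2 * K * Suc s \<le> n" using 2(2) L(1) by (meson le_trans mult_le_mono1)
      moreover have "2 * n < 2 * K * a + 2 * K * Suc s" using 2(1) by (simp add: algebra_simps)
      ultimately have "n < 2 * K * a" by linarith
      then have "n \<le> 4 * K * a" by simp
      then have "D ^ n \<le> (D ^ (4 * K)) ^ a" using D by (simp flip: power_mult)
      also have "\<dots> \<le> L ^ a" by (intro power_mono) (auto simp: L_def)
      finally have "D ^ n * (Suc s ^ a * Suc (a + s) ^ b) \<le> L ^ a * (Suc s ^ a * n ^ b)"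
        using asb by (intro mult_mono) auto
      also have "\<dots> = (L * Suc s) ^ a * n ^ b" by (simp only: power_mult_distrib mult_ac)
      also have "\<dots> \<le> n ^ a * n ^ b" using 2 by (intro mult_mono power_mono) auto
      finally show ?thesis using ab by (simp add: power_add)
    next
      case 3
      have "n < L * s + L" using 3 by simp
      then have "n \<le> 4 * L * s" using n(2) by linarith
      then have "D ^ n \<le> (D ^ (4 * L)) ^ s" using D by (simp flip: power_mult)
      also have "\<dots> \<le> n ^ s" by (intro power_mono) (auto simp: n_def)
      finally have "D ^ n * (Suc s ^ a * Suc (a + s) ^ b) \<le> n ^ s * (n ^ a * n ^ b)"
        using asb sa by (intro mult_mono) auto
      then show ?thesis using sab by (simp add: power_add[symmetric] add.assoc)
    qed
  qed
  have "C ^ n * (Suc s ^ a * Suc (a + s) ^ b) < fact n" if "s + a + b = n" for s a b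
  proof -
    have "3 ^ n * (C ^ n * (Suc s ^ a * Suc (a + s) ^ b)) =
        (3 * C) ^ n * (Suc s ^ a * Suc (a + s) ^ b)"
      by (simp add: power_mult_distrib)
    also have "\<dots> < D ^ n * (Suc s ^ a * Suc (a + s) ^ b)"
      using n by (intro mult_strict_right_mono power_strict_mono) (auto simp: D_def)
    also have "\<dots> \<le> 3 ^ n * fact n" using main[OF that] power_le_fact order_trans by blast
    finally show ?thesis by simp
  qed
  then show ?thesis using that by blast
qed

text \<open>At the first difference, the smaller of the two letters occurs in the other word at a
  later position. Its label gives both positions the same key, and on them the other word increases,
  a contradiction. This is used to decode irreducible words from their labels.\<close>

lemma list_eq_if_increasing_on_fibres:
  fixes v w :: "nat list"
  assumes "distinct v" "distinct w" "length v = length w"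
    and v_incr: "\<And>p q. p < q \<Longrightarrow> q < length v \<Longrightarrow> key p = key q \<Longrightarrow> v ! p < v ! q"
    and w_incr: "\<And>p q. p < q \<Longrightarrow> q < length w \<Longrightarrow> key p = key q \<Longrightarrow> w ! p < w ! q"
    and v_lab: "\<And>p. p < length v \<Longrightarrow> lab (v ! p) = key p"
    and w_lab: "\<And>p. p < length w \<Longrightarrow> lab (w ! p) = key p"
    and same: "set v = set w"
  shows "v = w"
proof (rule nth_equalityI)
  have step: "\<not> x ! p < y ! p"
    if IH: "\<And>q. q < p \<Longrightarrow> x ! q = y ! q" and p: "p < length x"
      and "distinct x" "length x = length y" "set x = set y"
      and y_incr: "\<And>p q. p < q \<Longrightarrow> q < length y \<Longrightarrow> key p = key q \<Longrightarrow> y ! p < y ! q"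
      and x_lab: "\<And>p. p < length x \<Longrightarrow> lab (x ! p) = key p"
      and y_lab: "\<And>p. p < length y \<Longrightarrow> lab (y ! p) = key p" for x y p
  proof
    assume less: "x ! p < y ! p"
    have "x ! p \<in> set y" using p that(5) by (metis nth_mem)
    then obtain q where q: "q < length y" "y ! q = x ! p" by (metis in_set_conv_nth)
    then have "key q = key p" using x_lab[OF p] y_lab[of q] by simp
    consider "q < p" | "q = p" | "p < q" by linarith
    then show False
    proof cases
      case 1
      then have "x ! q = x ! p" using IH q by simp
      then show False using 1 p that(3) by (simp add: nth_eq_iff_index_eq)
    next
      case 3
      then show False using y_incr[of p q] q \<open>key q = key p\<close> less by simp
    qed (use q less in simp)
  qed
  show "v ! p = w ! p" if "p < length v" for p
    using that
  proof (induction p rule: less_induct)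
    case (less p)
    have eq: "\<And>q. q < p \<Longrightarrow> v ! q = w ! q" using less by simp
    have "\<not> v ! p < w ! p"
      by (rule step[of p v w]) (use assms eq less.prems in auto)
    moreover have "\<not> w ! p < v ! p"
      by (rule step[of p w v]) (use assms eq less.prems in auto)
    ultimately show ?case by simp
  qed
qed (rule assms)

lemma lex_if_first_difference:
  assumes "length v = length w" "p < length w" "\<And>i. i < p \<Longrightarrow> v ! i = w ! i" "(v ! p, w ! p) \<in> r"
  shows "(v, w) \<in> lex r"
proof -
  have "take p v = take p w" using assms by (intro nth_equalityI) auto
  then have "v = take p w @ v ! p # drop (Suc p) v" "w = take p w @ w ! p # drop (Suc p) w"
    using assms(1,2) by (metis id_take_nth_drop)+
  moreover have "(take p w @ v ! p # drop (Suc p) v, take p w @ w ! p # drop (Suc p) w) \<in> lex r"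
    using assms by (intro lex_append_leftI) (simp add: Cons_in_lex)
  ultimately show ?thesis by simp
qed

section \<open>Cutting a word at chosen positions\<close>

fun segments :: "nat list \<Rightarrow> nat list list" where
  "segments [] = []"
| "segments [p] = [[p]]"
| "segments (p # q # ps) = [p..<q] # segments (q # ps)"

lemma length_segments [simp]: "length (segments ps) = length ps"
  by (induction ps rule: segments.induct) auto

lemma map_hd_segments: "sorted_wrt (<) ps \<Longrightarrow> map hd (segments ps) = ps"
  by (induction ps rule: segments.induct) (auto simp: upt_conv_Cons)

text \<open>The last segment is the last cut point alone, so the segments reach up to and including
  \<open>last ps\<close>, and there are as many of them as cut points.\<close>

lemma concat_segments:
  "sorted_wrt (<) ps \<Longrightarrow> ps \<noteq> [] \<Longrightarrow> concat (segments ps) = [hd ps..<Suc (last ps)]"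
proof (induction ps rule: segments.induct)
  case (3 p q ps)
  have "q \<le> last (q # ps)" using 3(2) by (cases "ps = []") (auto simp: less_imp_le)
  then have "[p..<Suc (last (q # ps))] = [p..<q] @ [q..<Suc (last (q # ps))]"
    using 3(2) upt_add_eq_append[of p q "Suc (last (q # ps)) - q"] by simp
  then show ?case using 3 by simp
qed auto

lemma segments_cases:
  "u \<in> set (segments ps) \<Longrightarrow> sorted_wrt (<) ps \<Longrightarrow>
    (\<exists>p\<in>set ps. u = [p]) \<or> (\<exists>p\<in>set ps. \<exists>q\<in>set ps. p < q \<and> u = [p..<q])"
proof (induction ps rule: segments.induct)
  case (3 p q ps)
  then consider "u = [p..<q]" | "u \<in> set (segments (q # ps))" by auto
  then show ?case
  proof cases
    case 1
    then show ?thesis using 3 by auto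
  next
    case 2
    have "sorted_wrt (<) (q # ps)" using 3(3) by simp
    from 3(1)[OF 2 this] show ?thesis by auto
  qed
qed auto

subsection \<open>Types and cells of letters\<close>

datatype 'a letter_type = InA | InB | Elt 'a

fun is_elt :: "'a letter_type \<Rightarrow> bool" where
  "is_elt (Elt e) = True"
| "is_elt _ = False"

definition elt_count :: "'a letter_type list \<Rightarrow> nat \<Rightarrow> nat" where
  "elt_count ts p = (\<Sum>q<p. if is_elt (ts ! q) then 1 else 0)"

definition nonB_count :: "'a letter_type list \<Rightarrow> nat \<Rightarrow> nat" where
  "nonB_count ts p = (\<Sum>q<p. if ts ! q \<noteq> InB then 1 else 0)"

text \<open>A passage is counted at its \<open>B\<close>-letter, so a passage into position
  \<open>p\<close> itself is included.\<close>

definition BA_count :: "'a letter_type list \<Rightarrow> nat \<Rightarrow> nat" where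
  "BA_count ts p = (\<Sum>q<p. if ts ! q = InB \<and> ts ! Suc q = InA then 1 else 0)"

lemma elt_count_mono: "p \<le> q \<Longrightarrow> elt_count ts p \<le> elt_count ts q"
  unfolding elt_count_def by (rule sum_mono2) auto

lemma nonB_count_mono: "p \<le> q \<Longrightarrow> nonB_count ts p \<le> nonB_count ts q"
  unfolding nonB_count_def by (rule sum_mono2) auto

lemma no_elt_between:
  assumes "elt_count ts p = elt_count ts q" "p \<le> r" "r < q"
  shows "\<not> is_elt (ts ! r)"
proof
  assume "is_elt (ts ! r)"
  then have "elt_count ts r < elt_count ts (Suc r)" by (simp add: elt_count_def)
  then show False
    using elt_count_mono[OF assms(2), of ts] elt_count_mono[OF Suc_leI[OF assms(3)], of ts] assms(1)
    by simp
qed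

lemma only_B_between:
  assumes "nonB_count ts p = nonB_count ts q" "p \<le> r" "r < q"
  shows "ts ! r = InB"
proof (rule ccontr)
  assume "ts ! r \<noteq> InB"
  then have "nonB_count ts r < nonB_count ts (Suc r)" by (simp add: nonB_count_def)
  then show False
    using nonB_count_mono[OF assms(2), of ts] nonB_count_mono[OF Suc_leI[OF assms(3)], of ts] assms(1)
    by simp
qed

text \<open>\<open>A\<close> and \<open>B\<close> will be the two ideals, in exchanged roles for the
  opposite algebra, and \<open>E\<close> collects representatives of finite spanning sets of both
  quotients. The exponent in the hypothesis \<open>alternating\<close> is
  \<open>k + 1\<close>.\<close>

locale almost_sum = bilinear_algebra scale m
  for scale :: "'f::field \<Rightarrow> 'a::ab_group_add \<Rightarrow> 'a"  (infixr \<open>*s\<close> 75)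
    and m :: "'a \<Rightarrow> 'a \<Rightarrow> 'a"  (infixl \<open>\<star>\<close> 70) +
  fixes A B E :: "'a set" and k :: nat and dA dB :: nat and cA cB :: "nat list \<Rightarrow> 'f"
  assumes closedA: "mult_closed A" and closedB: "mult_closed B"
    and idA: "multilinear_identity dA cA A" and idB: "multilinear_identity dB cB B"
    and finE: "finite E" and spanning: "span (A \<union> B \<union> E) = UNIV"
    and alternating: "alternating m A B k \<subseteq> A"
begin

fun letter_values :: "'a letter_type \<Rightarrow> 'a set" where
  "letter_values InA = A"
| "letter_values InB = B"
| "letter_values (Elt e) = {e}"

text \<open>Two letters in \<open>A\<close> (or two in \<open>B\<close>) with the same cell delimit a segment whose product lies in
  \<open>A\<close> (or in \<open>B\<close>). For \<open>A\<close> this is where the hypothesis on $(AB)^{k+1}$ enters: the segment contains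
  no letter from \<open>E\<close>, and its number of passages from \<open>B\<close> to \<open>A\<close> is a multiple of \<open>k + 1\<close>.\<close>

definition cell :: "'a letter_type list \<Rightarrow> nat \<Rightarrow> nat" where
  "cell ts p = (case ts ! p of
     InA \<Rightarrow> elt_count ts p * Suc k + BA_count ts p mod Suc k
   | InB \<Rightarrow> nonB_count ts p
   | Elt e \<Rightarrow> 0)"

definition key :: "'a letter_type list \<Rightarrow> nat \<Rightarrow> 'a letter_type \<times> nat" where
  "key ts p = (ts ! p, cell ts p)"

definition fits :: "nat \<Rightarrow> (nat \<Rightarrow> 'a letter_type) \<Rightarrow> (nat \<Rightarrow> 'a) \<Rightarrow> bool" where
  "fits n t y \<longleftrightarrow> (\<forall>i<n. y i \<in> letter_values (t i))"

section \<open>Products of the segments between letters of one cell\<close>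

lemma prd_closed:
  "mult_closed S \<Longrightarrow> xs \<noteq> [] \<Longrightarrow> set xs \<subseteq> S \<Longrightarrow> prd xs \<in> S"
proof (induction xs)
  case (Cons x xs)
  then show ?case
    by (cases "xs = []") (auto simp: prd_Cons mult_closed_def simp del: mprod.simps, simp_all)
qed simp

text \<open>The indices \<open>c\<close> and \<open>c'\<close> stand for the exponents
  \<open>c + 1\<close> and \<open>c' + 1\<close>, so the index of the product is
  \<open>c + Suc c'\<close>.\<close>

lemma alternating_split:
  "x \<in> alternating m A B (c + Suc c') \<Longrightarrow>
    \<exists>u\<in>alternating m A B c. \<exists>v\<in>alternating m A B c'. x = u \<star> v"
proof (induction c' arbitrary: x)
  case (Suc c')
  then have "x \<in> alternating m A B (Suc (c + Suc c'))" by simp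
  then obtain x' a b where x': "x' \<in> alternating m A B (c + Suc c')" "a \<in> A" "b \<in> B" "x = x' \<star> (a \<star> b)"
    unfolding alternating.simps(2) by blast
  then obtain u v where "u \<in> alternating m A B c" "v \<in> alternating m A B c'" "x' = u \<star> v"
    using Suc.IH by blast
  moreover from this x' have "v \<star> (a \<star> b) \<in> alternating m A B (Suc c')" by auto
  ultimately show ?case using x' assoc by metis
qed auto

text \<open>The index stands for the exponent \<open>(q + 1) * (k + 1)\<close>: the product splits
  into \<open>q + 1\<close> factors from \<open>(AB)^(k+1)\<close>, each in \<open>A\<close>, and
  \<open>A\<close> is closed.\<close>

lemma alternating_multiple: "alternating m A B (q * Suc k + k) \<subseteq> A"
proof (induction q)
  case (Suc q)
  show ?case
  proof
    fix x assume "x \<in> alternating m A B (Suc q * Suc k + k)"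
    then have "x \<in> alternating m A B ((q * Suc k + k) + Suc k)"
      by (simp add: add_ac)
    from alternating_split[OF this] show "x \<in> A"
      using Suc alternating closedA by (auto simp: mult_closed_def)
  qed
qed (use alternating in simp)

lemma alternating_mult_B:
  assumes "x \<in> alternating m A B c" "b \<in> B"
  shows "x \<star> b \<in> alternating m A B c"
proof (cases c)
  case 0
  then obtain a b' where "a \<in> A" "b' \<in> B" "x = a \<star> b'" using assms(1) by auto
  moreover from this have "b' \<star> b \<in> B" using assms(2) closedB by (simp add: mult_closed_def)
  ultimately show ?thesis using 0 assoc by auto
next
  case (Suc c')
  then obtain x' a b' where "x' \<in> alternating m A B c'" "a \<in> A" "b' \<in> B" "x = x' \<star> (a \<star> b')"
    using assms(1) by auto
  moreover from this have "b' \<star> b \<in> B" using assms(2) closedB by (simp add: mult_closed_def)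
  ultimately show ?thesis using Suc assoc by auto
qed

text \<open>The possible products of a word that starts and ends with letters in \<open>A\<close> and passes \<open>c\<close> times
  from \<open>B\<close> to \<open>A\<close>.\<close>

definition alternating_A :: "nat \<Rightarrow> 'a set" where
  "alternating_A c = (case c of 0 \<Rightarrow> A | Suc c' \<Rightarrow> {x \<star> a | x a. x \<in> alternating m A B c' \<and> a \<in> A})"

lemma alternating_A_mult_A: "x \<in> alternating_A c \<Longrightarrow> a \<in> A \<Longrightarrow> x \<star> a \<in> alternating_A c"
  using closedA by (cases c) (auto simp: alternating_A_def mult_closed_def, metis assoc)

lemma alternating_A_mult_B: "x \<in> alternating_A c \<Longrightarrow> b \<in> B \<Longrightarrow> x \<star> b \<in> alternating m A B c"
  by (cases c) (auto simp: alternating_A_def assoc, blast)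

lemma alternating_multiple':
  assumes "Suc c mod Suc k = 0"
  shows "alternating m A B c \<subseteq> A"
proof -
  from assms obtain q where q: "Suc c = Suc k * q" by (auto simp: mod_eq_0_iff_dvd)
  then obtain q' where "q = Suc q'" by (cases q) auto
  with q have "c = q' * Suc k + k" by (simp add: algebra_simps)
  then show ?thesis using alternating_multiple by simp
qed

lemma alternating_A_multiple:
  assumes "c mod Suc k = 0"
  shows "alternating_A c \<subseteq> A"
proof (cases c)
  case (Suc c')
  have "alternating m A B c' \<subseteq> A" using alternating_multiple'[OF assms[unfolded Suc]] .
  then show ?thesis using Suc closedA by (auto simp: alternating_A_def mult_closed_def)
qed (simp add: alternating_A_def)

text \<open>Induction on the right end \<open>q\<close>. A letter of the same type as its
  predecessor is absorbed, a letter from \<open>B\<close> after one from \<open>A\<close> completes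
  a pair, and a letter from \<open>A\<close> after one from \<open>B\<close> opens the next pair and
  raises both \<open>c\<close> and \<open>BA_count\<close> by one.\<close>

lemma block_in_alternating:
  assumes start: "ts ! p = InA" and "p \<le> q"
    and no_elt: "\<And>r. p \<le> r \<Longrightarrow> r \<le> q \<Longrightarrow> \<not> is_elt (ts ! r)"
    and z: "\<And>r. p \<le> r \<Longrightarrow> r \<le> q \<Longrightarrow> z r \<in> letter_values (ts ! r)"
  shows "\<exists>c. BA_count ts q = BA_count ts p + c \<and>
    prd (map z [p..<Suc q]) \<in> (if ts ! q = InA then alternating_A c else alternating m A B c)"
  using assms(2-4)
proof (induction q rule: dec_induct)
  case base
  then show ?case using start base(2)[of p] by (auto simp: alternating_A_def)
next
  case (step q)
  then obtain c where c: "BA_count ts q = BA_count ts p + c"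
    "prd (map z [p..<Suc q]) \<in> (if ts ! q = InA then alternating_A c else alternating m A B c)"
    by auto
  have prd_eq: "prd (map z [p..<Suc (Suc q)]) = prd (map z [p..<Suc q]) \<star> z (Suc q)"
    using step.hyps prd_append[of "map z [p..<Suc q]" "[z (Suc q)]"] by simp
  have zq: "z (Suc q) \<in> letter_values (ts ! Suc q)" using step by simp
  have BA: "BA_count ts (Suc q) = BA_count ts q + (if ts ! q = InB \<and> ts ! Suc q = InA then 1 else 0)"
    by (simp add: BA_count_def)
  have "ts ! q = InA \<or> ts ! q = InB" using step.prems(1)[of q] step.hyps by (cases "ts ! q") auto
  moreover have "ts ! Suc q = InA \<or> ts ! Suc q = InB"
    using step.prems(1)[of "Suc q"] step.hyps by (cases "ts ! Suc q") auto
  ultimately consider "ts ! q = InA" "ts ! Suc q = InA" | "ts ! q = InA" "ts ! Suc q = InB"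
    | "ts ! q = InB" "ts ! Suc q = InB" | "ts ! q = InB" "ts ! Suc q = InA"
    by blast
  then show ?case
  proof cases
    case 1
    then show ?thesis unfolding prd_eq using c BA zq alternating_A_mult_A by auto
  next
    case 2
    then show ?thesis unfolding prd_eq using c BA zq alternating_A_mult_B by auto
  next
    case 3
    then show ?thesis unfolding prd_eq using c BA zq alternating_mult_B by auto
  next
    case 4
    then have "prd (map z [p..<Suc q]) \<star> z (Suc q) \<in> alternating_A (Suc c)"
      using c(2) zq by (auto simp: alternating_A_def simp del: upt_Suc)
    then show ?thesis unfolding prd_eq using 4 c BA by (intro exI[of _ "Suc c"]) simp
  qed
qed

text \<open>The passages counted between \<open>p\<close> and \<open>q\<close> include one into
  \<open>q\<close> if the segment ends in \<open>B\<close>. So their number, a multiple of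
  \<open>k + 1\<close>, is the exponent of \<open>AB\<close> in either case: the product lies in
  \<open>(AB)^c A\<close> if the segment ends in \<open>A\<close>, and in \<open>(AB)^(c+1)\<close>
  if it ends in \<open>B\<close>.\<close>

lemma segment_in_A:
  assumes "ts ! p = InA" "ts ! q = InA" "p < q" "cell ts p = cell ts q"
    and z: "\<And>r. p \<le> r \<Longrightarrow> r < q \<Longrightarrow> z r \<in> letter_values (ts ! r)"
  shows "prd (map z [p..<q]) \<in> A"
proof -
  have eq: "elt_count ts p * Suc k + BA_count ts p mod Suc k = elt_count ts q * Suc k + BA_count ts q mod Suc k"
    using assms by (simp add: cell_def)
  \<comment> \<open>Division by \<open>Suc k\<close> separates the count from the residue, which is
    a digit in base \<open>Suc k\<close>.\<close>
  have "elt_count ts p = elt_count ts q"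
    using arg_cong[OF eq, of "\<lambda>x. x div Suc k"] by (simp del: mult_Suc_right)
  with eq have BA: "BA_count ts p mod Suc k = BA_count ts q mod Suc k" by simp
  obtain q' where q': "q = Suc q'" "p \<le> q'" using assms(3) by (cases q) auto
  have no_elt: "\<not> is_elt (ts ! r)" if "p \<le> r" "r \<le> q'" for r
    using no_elt_between[OF \<open>elt_count ts p = elt_count ts q\<close> that(1)] that(2) q' by simp
  obtain c where c: "BA_count ts q' = BA_count ts p + c"
    "prd (map z [p..<q]) \<in> (if ts ! q' = InA then alternating_A c else alternating m A B c)"
    using block_in_alternating[OF assms(1) q'(2) no_elt, of z] z q' by auto
  have BA_q: "BA_count ts q = BA_count ts q' + (if ts ! q' = InB then 1 else 0)"
    using assms(2) q' by (simp add: BA_count_def)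
  have cancel: "x mod Suc k = 0" if "(BA_count ts p + x) mod Suc k = BA_count ts p mod Suc k" for x
    using that by (metis add.right_neutral add_diff_cancel_left' mod_eq_dvd_iff_nat le_add1 mod_eq_0_iff_dvd)
  have ab: "ts ! q' = InA \<or> ts ! q' = InB" using no_elt[of q'] q' by (cases "ts ! q'") auto
  show ?thesis
  proof (cases "ts ! q' = InA")
    case True
    then have "BA_count ts q = BA_count ts p + c" using BA_q c(1) by simp
    then have "c mod Suc k = 0" using BA cancel[of c] by simp
    then show ?thesis using alternating_A_multiple[of c] c(2) True by (simp add: subset_iff)
  next
    case False
    then have "BA_count ts q = BA_count ts p + Suc c" using BA_q c(1) ab by simp
    then have "Suc c mod Suc k = 0" using BA cancel[of "Suc c"] by simp
    from alternating_multiple'[OF this] show ?thesis using c(2) False by auto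
  qed
qed

lemma segment_in_B:
  assumes "ts ! p = InB" "ts ! q = InB" "p < q" "cell ts p = cell ts q"
    and z: "\<And>r. p \<le> r \<Longrightarrow> r < q \<Longrightarrow> z r \<in> letter_values (ts ! r)"
  shows "prd (map z [p..<q]) \<in> B"
proof (rule prd_closed[OF closedB])
  have eq: "nonB_count ts p = nonB_count ts q" using assms by (simp add: cell_def)
  show "set (map z [p..<q]) \<subseteq> B"
    using z only_B_between[OF eq] by fastforce
qed (use assms in simp)

end

subsection \<open>Reducible words\<close>

context almost_sum
begin

text \<open>The coefficients \<open>r\<close> do not depend on the values \<open>y\<close>. This
  uniformity later turns the vanishing conditions into linear equations over the field.\<close>

definition reducible :: "nat \<Rightarrow> (nat \<Rightarrow> 'a letter_type) \<Rightarrow> nat list \<Rightarrow> bool" where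
  "reducible n t w \<longleftrightarrow> (\<exists>(I :: nat list set) r g. finite I \<and>
     (\<forall>\<sigma>\<in>I. g \<sigma> \<in> permutations_of_set {..<n} \<and> (g \<sigma>, w) \<in> lex {(x, y). x < y}) \<and>
     (\<forall>y. fits n t y \<longrightarrow> prd (map y w) = (\<Sum>\<sigma>\<in>I. r \<sigma> *s prd (map y (g \<sigma>)))))"

lemma permutations_of_set_mset_cong:
  "w \<in> permutations_of_set S \<Longrightarrow> mset v = mset w \<Longrightarrow> v \<in> permutations_of_set S"
  by (metis mset_eq_imp_distinct_iff mset_eq_setD permutations_of_setD(1,2) permutations_of_setI)

lemma prd_replace:
  "us \<noteq> [] \<Longrightarrow> prd (xs @ us @ zs) = prd (xs @ [prd us] @ zs)"
  by (cases "xs = []"; cases "zs = []")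
    (simp_all add: prd_append prd_Cons del: mprod.simps, simp_all)

text \<open>The products of the blocks are substituted into the identity, which is solved for the
  term of \<open>[0..<d]\<close>. Every other term rearranges the blocks, whose heads decrease, and
  is smaller by \<open>concat_permuted_lex\<close>.\<close>

lemma reducible_by_identity:
  assumes id: "multilinear_identity d c S"
    and len: "length us = d" and ne: "\<forall>u\<in>set us. u \<noteq> []"
    and decr: "sorted_wrt (\<lambda>u v. hd u > hd v) us"
    and w: "w = pre @ concat us @ post" "w \<in> permutations_of_set {..<n}"
    and S: "\<And>y u. fits n t y \<Longrightarrow> u \<in> set us \<Longrightarrow> prd (map y u) \<in> S"
  shows "reducible n t w"
proof -
  let ?P = "permutations_of_set {..<d}"
  let ?id = "[0..<d]"
  have d: "d > 0" and c: "c ?id \<noteq> 0"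
    and vanish: "\<And>z. \<forall>i<d. z i \<in> S \<Longrightarrow> (\<Sum>\<sigma>\<in>?P. c \<sigma> *s prd (map z \<sigma>)) = 0"
    using id unfolding multilinear_identity_def by auto
  define h where "h \<sigma> = concat (map ((!) us) \<sigma>)" for \<sigma>
  define g where "g \<sigma> = pre @ h \<sigma> @ post" for \<sigma>
  have idP: "?id \<in> ?P" by (auto simp: permutations_of_set_def)
  have h_id: "h ?id = concat us" by (simp add: h_def len[symmetric] map_nth)
  have "distinct us"
    using decr by (induction us) auto
  have P: "mset (map ((!) us) \<sigma>) = mset us" "\<sigma> \<noteq> []" "length \<sigma> = d" "set \<sigma> = {..<d}" if "\<sigma> \<in> ?P" for \<sigma>
  proof -
    have "mset \<sigma> = mset ?id"
      using that idP by (metis permutations_of_setD set_eq_iff_mset_eq_distinct)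
    then have "mset (map ((!) us) \<sigma>) = mset (map ((!) us) ?id)" by (simp only: mset_map)
    then show "mset (map ((!) us) \<sigma>) = mset us" by (simp only: len[symmetric] map_nth)
    show "length \<sigma> = d" using \<open>mset \<sigma> = mset ?id\<close> by (metis mset_eq_length length_upt minus_nat.diff_0)
    then show "\<sigma> \<noteq> []" using d by auto
    show "set \<sigma> = {..<d}" using that by (simp add: permutations_of_setD)
  qed
  have h_ne: "h \<sigma> \<noteq> []" if "\<sigma> \<in> ?P" for \<sigma>
  proof -
    have "hd \<sigma> \<in> set \<sigma>" using P(2)[OF that] by simp
    moreover from this have "us ! hd \<sigma> \<noteq> []" using P(4)[OF that] ne len by simp
    ultimately show ?thesis unfolding h_def by auto
  qed
  have g_perm: "g \<sigma> \<in> permutations_of_set {..<n}" if "\<sigma> \<in> ?P" for \<sigma>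
  proof (rule permutations_of_set_mset_cong[OF w(2)])
    have "mset (h \<sigma>) = mset (concat us)"
      unfolding h_def mset_concat using arg_cong[OF P(1)[OF that], of "\<lambda>M. sum_mset (image_mset mset M)"]
      by (simp only: mset_map[symmetric] sum_mset_sum_list)
    then show "mset (g \<sigma>) = mset w" by (simp add: g_def w(1))
  qed
  have g_less: "(g \<sigma>, w) \<in> lex {(x, y). x < y}" if "\<sigma> \<in> ?P - {?id}" for \<sigma>
  proof -
    have \<sigma>: "\<sigma> \<in> ?P" "\<sigma> \<noteq> ?id" using that by auto
    \<comment> \<open>The blocks are pairwise distinct, so only the identity permutation leaves
      their order unchanged.\<close>
    have "map ((!) us) \<sigma> \<noteq> us"
    proof
      assume eq: "map ((!) us) \<sigma> = us"
      have "\<sigma> ! i = i" if "i < d" for i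
      proof -
        have "us ! (\<sigma> ! i) = us ! i" using arg_cong[OF eq, of "\<lambda>l. l ! i"] that P(3)[OF \<sigma>(1)] by simp
        moreover have "\<sigma> ! i < d" using P(3,4)[OF \<sigma>(1)] that nth_mem by blast
        ultimately show ?thesis using \<open>distinct us\<close> len that by (simp add: nth_eq_iff_index_eq)
      qed
      then have "\<sigma> = ?id" using P(3)[OF \<sigma>(1)] by (intro nth_equalityI) auto
      then show False using \<sigma> by simp
    qed
    then have "(h \<sigma>, concat us) \<in> lex {(x, y). x < y}"
      unfolding h_def using P(1)[OF \<sigma>(1)] ne decr by (intro concat_permuted_lex) auto
    then show ?thesis unfolding g_def w(1) by (intro lex_append_leftI lex_append_rightI) auto
  qed
  have "prd (map y w) = (\<Sum>\<sigma>\<in>?P - {?id}. (- (c \<sigma> / c ?id)) *s prd (map y (g \<sigma>)))"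
    if y: "fits n t y" for y
  proof -
    have h: "prd (map y (h \<sigma>)) = prd (map (\<lambda>i. prd (map y (us ! i))) \<sigma>)" if "\<sigma> \<in> ?P" for \<sigma>
    proof -
      have "prd (concat (map (\<lambda>i. map y (us ! i)) \<sigma>)) = prd (map prd (map (\<lambda>i. map y (us ! i)) \<sigma>))"
      proof (rule prd_concat)
        show "map (\<lambda>i. map y (us ! i)) \<sigma> \<noteq> []" using P(2)[OF that] by simp
        fix u assume "u \<in> set (map (\<lambda>i. map y (us ! i)) \<sigma>)"
        then obtain i where "i \<in> set \<sigma>" "u = map y (us ! i)" by auto
        then show "u \<noteq> []" using P(4)[OF that] ne len by simp
      qed
      then show ?thesis by (simp add: h_def map_concat comp_def)
    qed
    have "(\<Sum>\<sigma>\<in>?P. c \<sigma> *s prd (map y (h \<sigma>))) = (\<Sum>\<sigma>\<in>?P. c \<sigma> *s prd (map (\<lambda>i. prd (map y (us ! i))) \<sigma>))"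
      using h by simp
    also have "\<dots> = 0" using S[OF y] len by (intro vanish) auto
    finally have 0: "(\<Sum>\<sigma>\<in>?P. c \<sigma> *s prd (map y (h \<sigma>))) = 0" .
    \<comment> \<open>Each rearranged product becomes one slot between \<open>pre\<close> and
      \<open>post\<close>; both may be empty, and there need be no unity to fill them.\<close>
    have "(\<Sum>\<sigma>\<in>?P. c \<sigma> *s prd (map y (g \<sigma>))) =
        (\<Sum>\<sigma>\<in>?P. c \<sigma> *s prd (map y pre @ [prd (map y (h \<sigma>))] @ map y post))"
      unfolding g_def map_append using h_ne
      by (intro sum.cong refl arg_cong[where f = "\<lambda>x. _ *s x"] prd_replace) auto
    also have "\<dots> = prd (map y pre @ [0] @ map y post)"
      by (simp only: prd_context_sum[symmetric] 0)
    also have "\<dots> = 0" using prd_slot_scale[of "map y pre" 0 0 "map y post"] by simp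
    finally have "c ?id *s prd (map y w) + (\<Sum>\<sigma>\<in>?P - {?id}. c \<sigma> *s prd (map y (g \<sigma>))) = 0"
      using idP by (simp add: sum.remove[OF _ idP] g_def h_id w(1))
    then have "c ?id *s prd (map y w) = - (\<Sum>\<sigma>\<in>?P - {?id}. c \<sigma> *s prd (map y (g \<sigma>)))"
      by (simp add: eq_neg_iff_add_eq_0)
    then have "(1 / c ?id) *s (c ?id *s prd (map y w)) =
        (1 / c ?id) *s (- (\<Sum>\<sigma>\<in>?P - {?id}. c \<sigma> *s prd (map y (g \<sigma>))))"
      by simp
    then show ?thesis using c by (simp add: scale_sum_right sum_negf)
  qed
  note expansion = this
  show ?thesis
    unfolding reducible_def
  proof (intro exI conjI)
    show "finite (?P - {?id})" by simp
    show "\<forall>\<sigma>\<in>?P - {?id}. g \<sigma> \<in> permutations_of_set {..<n} \<and> (g \<sigma>, w) \<in> lex {(x, y). x < y}"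
      using g_perm g_less by blast
    show "\<forall>y. fits n t y \<longrightarrow>
        prd (map y w) = (\<Sum>\<sigma>\<in>?P - {?id}. (- (c \<sigma> / c ?id)) *s prd (map y (g \<sigma>)))"
      using expansion by blast
  qed
qed

text \<open>Both letters take the value \<open>e\<close>, so exchanging them does not change the
  product.\<close>

lemma reducible_swap:
  assumes w: "w \<in> permutations_of_set {..<n}" and pq: "p < q" "q < n"
    and t: "t (w ! p) = Elt e" "t (w ! q) = Elt e" and less: "w ! q < w ! p"
  shows "reducible n t w"
proof -
  have len: "length w = n" using w by (simp add: length_finite_permutations_of_set)
  let ?v = "w[p := w ! q, q := w ! p]"
  have "?v \<in> permutations_of_set {..<n}"
    using mset_swap[of q w p] len pq by (intro permutations_of_set_mset_cong[OF w]) (simp add: list_update_swap)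
  moreover have "(?v, w) \<in> lex {(x, y). x < y}"
    using len pq less by (intro lex_if_first_difference[of _ _ p]) auto
  moreover have "prd (map y w) = prd (map y ?v)" if "fits n t y" for y
  proof -
    have "w ! p \<in> {..<n}" "w ! q \<in> {..<n}"
      using w len pq by (metis nth_mem order.strict_trans permutations_of_setD(1))+
    then have y: "y (w ! p) = e" "y (w ! q) = e" using that t unfolding fits_def by force+
    have "map y w = map y ?v"
      using y len pq by (intro nth_equalityI) (auto simp: nth_list_update)
    then show ?thesis by simp
  qed
  \<comment> \<open>The one-element index set \<open>{[]}\<close> is a dummy; the expansion has the
    single term \<open>?v\<close>.\<close>
  ultimately show ?thesis
    unfolding reducible_def
    by (intro exI[of _ "{[]}"] exI[of _ "\<lambda>_. 1"] exI[of _ "\<lambda>_. ?v"]) auto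
qed

text \<open>A chain for this relation cuts a word into consecutive segments with decreasing first letters;
  the identity of \<open>A\<close> or \<open>B\<close> then permutes the segments into lexicographically smaller words.\<close>

definition descends :: "(nat \<Rightarrow> 'a letter_type) \<Rightarrow> nat list \<Rightarrow> nat \<Rightarrow> nat \<Rightarrow> bool" where
  "descends t w p q \<longleftrightarrow> p < q \<and> w ! q < w ! p \<and> key (map t w) p = key (map t w) q"

lemma reducible_chain_by_identity:
  assumes id: "multilinear_identity d c S" and w: "w \<in> permutations_of_set {..<n}"
    and ps: "length ps = d" "set ps \<subseteq> {..<n}" "sorted_wrt (descends t w) ps"
    and S: "\<And>y p q. fits n t y \<Longrightarrow> p \<in> set ps \<Longrightarrow> q \<in> set ps \<Longrightarrow> p < q \<Longrightarrow>
      prd (map (\<lambda>r. y (w ! r)) [p..<q]) \<in> S"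
    and S1: "\<And>y p. fits n t y \<Longrightarrow> p \<in> set ps \<Longrightarrow> y (w ! p) \<in> S"
  shows "reducible n t w"
proof (rule reducible_by_identity[OF id])
  let ?us = "map (map ((!) w)) (segments ps)"
  have len: "length w = n" using w by (simp add: length_finite_permutations_of_set)
  have "ps \<noteq> []" using id ps(1) by (auto simp: multilinear_identity_def)
  have sorted: "sorted_wrt (<) ps"
    using ps(3) by (rule sorted_wrt_mono_rel[rotated]) (simp add: descends_def)
  have ne: "u \<noteq> []" if "u \<in> set (segments ps)" for u
    using segments_cases[OF that sorted] by (auto dest!: sym[of "[]"])
  show "length ?us = d" using ps(1) by simp
  show "\<forall>u\<in>set ?us. u \<noteq> []" using ne by auto
  have "sorted_wrt (\<lambda>p q. w ! q < w ! p) (map hd (segments ps))"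
    unfolding map_hd_segments[OF sorted]
    using ps(3) by (rule sorted_wrt_mono_rel[rotated]) (simp add: descends_def)
  then show "sorted_wrt (\<lambda>u v. hd v < hd u) ?us"
    unfolding sorted_wrt_map by (rule sorted_wrt_mono_rel[rotated]) (simp add: hd_map ne)
  have last: "last ps < n" using \<open>ps \<noteq> []\<close> ps(2) last_in_set by blast
  have "hd ps \<le> last ps" using sorted \<open>ps \<noteq> []\<close> by (cases ps) (auto simp: less_imp_le)
  then have "[0..<n] = [0..<hd ps] @ [hd ps..<Suc (last ps)] @ [Suc (last ps)..<n]"
    using last upt_add_eq_append[of 0 "hd ps" "n - hd ps"]
      upt_add_eq_append[of "hd ps" "Suc (last ps)" "n - Suc (last ps)"] by (simp del: upt_Suc)
  then have "map ((!) w) [0..<n] = map ((!) w) [0..<hd ps] @ map ((!) w) [hd ps..<Suc (last ps)] @ map ((!) w) [Suc (last ps)..<n]"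
    by (metis map_append)
  then show "w = map ((!) w) [0..<hd ps] @ concat ?us @ map ((!) w) [Suc (last ps)..<n]"
    using concat_segments[OF sorted \<open>ps \<noteq> []\<close>] map_nth[of w, unfolded len]
    by (simp add: map_concat[symmetric] del: upt_Suc)
  show "w \<in> permutations_of_set {..<n}" by fact
  show "prd (map y u) \<in> S" if y: "fits n t y" and u: "u \<in> set ?us" for y u
  proof -
    obtain v where v: "v \<in> set (segments ps)" "u = map ((!) w) v" using u by auto
    show ?thesis
      using segments_cases[OF v(1) sorted] S[OF y] S1[OF y] by (auto simp: v(2) comp_def)
  qed
qed

text \<open>The key is constant along the chain, hence so is the type. The first \<open>dA\<close>
  or \<open>dB\<close> members serve the identity of \<open>A\<close> or \<open>B\<close>; for a
  fixed element two members suffice.\<close>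

lemma reducible_chain:
  assumes w: "w \<in> permutations_of_set {..<n}" and "length ps = Suc (dA + dB)"
    and "set ps \<subseteq> {..<n}" "successively (descends t w) ps"
  shows "reducible n t w"
proof -
  have len: "length w = n" using w by (simp add: length_finite_permutations_of_set)
  have wn: "w ! p < n" if "p < n" for p
    using w len that by (metis lessThan_iff nth_mem permutations_of_setD(1))
  have "transp (descends t w)" by (auto simp: transp_def descends_def)
  then have ps: "sorted_wrt (descends t w) ps"
    using assms(4) by (simp add: successively_conv_sorted_wrt)
  have d: "dA > 0" "dB > 0" using idA idB by (auto simp: multilinear_identity_def)
  have sub: "sorted_wrt (descends t w) (take d ps)" "set (take d ps) \<subseteq> {..<n}" for d
    using ps assms(3) by (auto simp: sorted_wrt_take dest: in_set_takeD)
  obtain p where p: "hd ps = p" "p \<in> set ps" using assms(2) by (cases ps) auto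
  have key: "key (map t w) q = key (map t w) p" if "q \<in> set ps" for q
    using ps p that by (cases ps) (auto simp: descends_def)
  have z: "y (w ! r) \<in> letter_values (map t w ! r)" if "fits n t y" "r < n" for y r
    using that wn len by (simp add: fits_def)
  show ?thesis
  proof (cases "map t w ! p")
    case InA
    have ty: "map t w ! q = InA" "q < n" if "q \<in> set (take dA ps)" for q
      using key[of q] that InA assms(3) by (auto simp: key_def dest: in_set_takeD)
    show ?thesis
    proof (rule reducible_chain_by_identity[OF idA w _ sub(2,1)])
      fix y q q' assume y: "fits n t y" and q: "q \<in> set (take dA ps)"
      show "y (w ! q) \<in> A" using z[OF y ty(2)[OF q]] ty(1)[OF q] by simp
      assume q': "q' \<in> set (take dA ps)" "q < q'"
      have "cell (map t w) q = cell (map t w) q'"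
        using key[OF in_set_takeD[OF q]] key[OF in_set_takeD[OF q'(1)]] by (simp add: key_def)
      then show "prd (map (\<lambda>r. y (w ! r)) [q..<q']) \<in> A"
        using segment_in_A[OF ty(1)[OF q] ty(1)[OF q'(1)] q'(2)] z[OF y] ty(2)[OF q'(1)] by simp
    qed (use assms(2) in simp)
  next
    case InB
    have ty: "map t w ! q = InB" "q < n" if "q \<in> set (take dB ps)" for q
      using key[of q] that InB assms(3) by (auto simp: key_def dest: in_set_takeD)
    show ?thesis
    proof (rule reducible_chain_by_identity[OF idB w _ sub(2,1)])
      fix y q q' assume y: "fits n t y" and q: "q \<in> set (take dB ps)"
      show "y (w ! q) \<in> B" using z[OF y ty(2)[OF q]] ty(1)[OF q] by simp
      assume q': "q' \<in> set (take dB ps)" "q < q'"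
      have "cell (map t w) q = cell (map t w) q'"
        using key[OF in_set_takeD[OF q]] key[OF in_set_takeD[OF q'(1)]] by (simp add: key_def)
      then show "prd (map (\<lambda>r. y (w ! r)) [q..<q']) \<in> B"
        using segment_in_B[OF ty(1)[OF q] ty(1)[OF q'(1)] q'(2)] z[OF y] ty(2)[OF q'(1)] by simp
    qed (use assms(2) in simp)
  next
    case (Elt e)
    obtain q ps' where ps': "ps = p # q # ps'"
      using assms(2) d p(1) by (cases ps; cases "tl ps") auto
    have "descends t w p q" "q < n" "p < n" using ps ps' assms(3) by auto
    moreover have "map t w ! q = Elt e" using key[of q] ps' Elt by (simp add: key_def)
    ultimately show ?thesis
      using reducible_swap[OF w, of p q t e] Elt len by (simp add: descends_def)
  qed
qed

definition irreducibles :: "nat \<Rightarrow> (nat \<Rightarrow> 'a letter_type) \<Rightarrow> nat list set" where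
  "irreducibles n t = {w\<in>permutations_of_set {..<n}. \<not> reducible n t w}"

text \<open>Rewriting reducible words terminates because the lexicographic order on words of equal
  length is well founded.\<close>

lemma irreducibles_span:
  assumes "w \<in> permutations_of_set {..<n}"
  shows "\<exists>\<rho>. \<forall>y. fits n t y \<longrightarrow> prd (map y w) = (\<Sum>u\<in>irreducibles n t. \<rho> u *s prd (map y u))"
  using assms
proof (induction w rule: wf_induct_rule[OF wf_lex[OF wf_less]])
  case (1 w)
  have fin: "finite (irreducibles n t)" by (simp add: irreducibles_def)
  show ?case
  proof (cases "reducible n t w")
    case False
    then have "w \<in> irreducibles n t" using 1 by (simp add: irreducibles_def)
    then have "(\<Sum>u\<in>irreducibles n t. (if u = w then 1 else 0) *s prd (map y u)) = prd (map y w)" for y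
      using fin by (subst sum.remove[of _ w]) auto
    then show ?thesis by (intro exI[of _ "\<lambda>u. if u = w then 1 else 0"]) simp
  next
    case True
    then obtain I :: "nat list set" and r g where I: "finite I"
      "\<And>\<sigma>. \<sigma> \<in> I \<Longrightarrow> g \<sigma> \<in> permutations_of_set {..<n} \<and> (g \<sigma>, w) \<in> lex {(x, y). x < y}"
      "\<And>y. fits n t y \<Longrightarrow> prd (map y w) = (\<Sum>\<sigma>\<in>I. r \<sigma> *s prd (map y (g \<sigma>)))"
      unfolding reducible_def by blast
    have "\<forall>\<sigma>\<in>I. \<exists>\<rho>. \<forall>y. fits n t y \<longrightarrow>
        prd (map y (g \<sigma>)) = (\<Sum>u\<in>irreducibles n t. \<rho> u *s prd (map y u))"
      using 1 I(2) by blast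
    then obtain \<rho> where \<rho>: "\<And>\<sigma> y. \<sigma> \<in> I \<Longrightarrow> fits n t y \<Longrightarrow>
        prd (map y (g \<sigma>)) = (\<Sum>u\<in>irreducibles n t. \<rho> \<sigma> u *s prd (map y u))"
      by metis
    have "prd (map y w) = (\<Sum>u\<in>irreducibles n t. (\<Sum>\<sigma>\<in>I. r \<sigma> * \<rho> \<sigma> u) *s prd (map y u))"
      if y: "fits n t y" for y
    proof -
      have "prd (map y w) = (\<Sum>\<sigma>\<in>I. r \<sigma> *s (\<Sum>u\<in>irreducibles n t. \<rho> \<sigma> u *s prd (map y u)))"
        using I(3)[OF y] \<rho>[OF _ y] by simp
      also have "\<dots> = (\<Sum>\<sigma>\<in>I. \<Sum>u\<in>irreducibles n t. (r \<sigma> * \<rho> \<sigma> u) *s prd (map y u))"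
        by (simp add: scale_sum_right)
      also have "\<dots> = (\<Sum>u\<in>irreducibles n t. \<Sum>\<sigma>\<in>I. (r \<sigma> * \<rho> \<sigma> u) *s prd (map y u))"
        by (rule sum.swap)
      finally show ?thesis by (simp add: scale_sum_left)
    qed
    then show ?thesis by (intro exI[of _ "\<lambda>u. \<Sum>\<sigma>\<in>I. r \<sigma> * \<rho> \<sigma> u"]) simp
  qed
qed

end

subsection \<open>Counting irreducible words\<close>

context almost_sum
begin

lemma irreducibles_colouring:
  assumes "w \<in> irreducibles n t"
  shows "\<exists>col. (\<forall>p<n. col p < dA + dB) \<and>
    (\<forall>p q. p < n \<longrightarrow> q < n \<longrightarrow> descends t w p q \<longrightarrow> col p \<noteq> col q)"
proof -
  have "\<not> successively (descends t w) ps" if "length ps = Suc (dA + dB)" "set ps \<subseteq> {..<n}" for ps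
    using assms reducible_chain[OF _ that] by (auto simp: irreducibles_def)
  from chain_free_colouring[of "dA + dB" "{..<n}" "descends t w", OF this]
  show ?thesis by auto
qed

definition elts_in :: "nat \<Rightarrow> (nat \<Rightarrow> 'a letter_type) \<Rightarrow> nat" where
  "elts_in n t = (\<Sum>i<n. if is_elt (t i) then 1 else 0)"

definition As_in :: "nat \<Rightarrow> (nat \<Rightarrow> 'a letter_type) \<Rightarrow> nat" where
  "As_in n t = (\<Sum>i<n. if t i = InA then 1 else 0)"

definition Bs_in :: "nat \<Rightarrow> (nat \<Rightarrow> 'a letter_type) \<Rightarrow> nat" where
  "Bs_in n t = (\<Sum>i<n. if t i = InB then 1 else 0)"

fun cell_bound :: "nat \<Rightarrow> (nat \<Rightarrow> 'a letter_type) \<Rightarrow> 'a letter_type \<Rightarrow> nat" where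
  "cell_bound n t InA = Suc (elts_in n t) * Suc k"
| "cell_bound n t InB = Suc (As_in n t + elts_in n t)"
| "cell_bound n t (Elt e) = 1"

lemma letter_counts_sum: "elts_in n t + As_in n t + Bs_in n t = n"
proof -
  have "elts_in n t + As_in n t + Bs_in n t = (\<Sum>i<n. 1)"
    unfolding elts_in_def As_in_def Bs_in_def sum.distrib[symmetric]
    by (rule sum.cong) (auto elim: is_elt.elims)
  then show ?thesis by simp
qed

lemma sum_over_permutation:
  assumes "w \<in> permutations_of_set {..<n}"
  shows "(\<Sum>q<n. g (w ! q)) = (\<Sum>i<n. g i :: nat)"
proof -
  have "length w = n" "distinct w" "set w = {..<n}"
    using assms by (simp_all add: length_finite_permutations_of_set permutations_of_setD)
  then have "bij_betw ((!) w) {..<n} {..<n}" by (intro bij_betw_nth) auto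
  then show ?thesis by (rule sum.reindex_bij_betw)
qed

text \<open>A count over the letters before \<open>p\<close> is at most the count over the whole
  word, which for a permutation depends only on \<open>t\<close>.\<close>

lemma cell_less_bound:
  assumes w: "w \<in> permutations_of_set {..<n}" and "p < n"
  shows "cell (map t w) p < cell_bound n t (t (w ! p))"
proof -
  have len: "length w = n" using w by (simp add: length_finite_permutations_of_set)
  have "elt_count (map t w) n = (\<Sum>q<n. if is_elt (t (w ! q)) then 1 else 0)"
    unfolding elt_count_def using len by (intro sum.cong) auto
  also have "\<dots> = elts_in n t" unfolding elts_in_def
    by (rule sum_over_permutation[OF w, of "\<lambda>i. if is_elt (t i) then 1 else 0"])
  finally have elt: "elt_count (map t w) p \<le> elts_in n t"
    using elt_count_mono[of p n "map t w"] assms(2) by simp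
  have "nonB_count (map t w) n = (\<Sum>q<n. if t (w ! q) \<noteq> InB then 1 else 0)"
    unfolding nonB_count_def using len by (intro sum.cong) auto
  also have "\<dots> = (\<Sum>i<n. if t i \<noteq> InB then 1 else 0)"
    by (rule sum_over_permutation[OF w, of "\<lambda>i. if t i \<noteq> InB then 1 else 0"])
  also have "\<dots> = As_in n t + elts_in n t"
    unfolding elts_in_def As_in_def sum.distrib[symmetric]
    by (rule sum.cong) (auto elim: is_elt.elims)
  finally have nonB: "nonB_count (map t w) p \<le> As_in n t + elts_in n t"
    using nonB_count_mono[of p n "map t w"] assms(2) by simp
  show ?thesis
  proof (cases "t (w ! p)")
    case InA
    have "elt_count (map t w) p * Suc k + BA_count (map t w) p mod Suc k <
        elt_count (map t w) p * Suc k + Suc k" by simp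
    also have "\<dots> = Suc (elt_count (map t w) p) * Suc k" by simp
    also have "\<dots> \<le> Suc (elts_in n t) * Suc k" using elt by (intro mult_le_mono1) simp
    finally show ?thesis using InA assms(2) len by (simp add: cell_def)
  qed (use nonB assms(2) len in \<open>simp_all add: cell_def\<close>)
qed

text \<open>Letters of type \<open>Elt\<close> have one cell each and contribute the factor 1, the
  saving exploited in \<open>label_count_less_fact\<close>.\<close>

lemma prod_cell_bound:
  "(\<Prod>i<n. cell_bound n t (t i)) =
    (Suc (elts_in n t) * Suc k) ^ As_in n t * Suc (As_in n t + elts_in n t) ^ Bs_in n t"
proof -
  have "(\<Prod>i<n. cell_bound n t (t i)) =
      (\<Prod>i<n. cell_bound n t InA ^ (if t i = InA then 1 else 0) *
        cell_bound n t InB ^ (if t i = InB then 1 else 0))"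
  proof (rule prod.cong[OF refl])
    fix i show "cell_bound n t (t i) = cell_bound n t InA ^ (if t i = InA then 1 else 0) *
        cell_bound n t InB ^ (if t i = InB then 1 else 0)"
      by (cases "t i") auto
  qed
  also have "\<dots> = cell_bound n t InA ^ As_in n t * cell_bound n t InB ^ Bs_in n t"
    unfolding prod.distrib power_sum[symmetric] As_in_def[of n t] Bs_in_def[of n t] ..
  finally show ?thesis by simp
qed

text \<open>An irreducible word is recovered from the types and colours of its positions together with the
  cell and colour of each letter: the letters with a given label occur in increasing order.\<close>

lemma card_irreducibles_le:
  assumes T: "finite T" "\<And>i. i < n \<Longrightarrow> t i \<in> T"
  shows "card (irreducibles n t) \<le> (card T * (dA + dB) ^ 2 * Suc k) ^ n *
    (Suc (elts_in n t) ^ As_in n t * Suc (As_in n t + elts_in n t) ^ Bs_in n t)"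
proof -
  let ?I = "irreducibles n t" and ?D = "dA + dB"
  have "\<forall>w\<in>?I. \<exists>col. (\<forall>p<n. col p < ?D) \<and>
      (\<forall>p q. p < n \<longrightarrow> q < n \<longrightarrow> descends t w p q \<longrightarrow> col p \<noteq> col q)"
    using irreducibles_colouring by blast
  from bchoice[OF this] obtain col where "\<forall>w\<in>?I. (\<forall>p<n. col w p < ?D) \<and>
      (\<forall>p q. p < n \<longrightarrow> q < n \<longrightarrow> descends t w p q \<longrightarrow> col w p \<noteq> col w q)"
    by blast
  then have col: "\<And>w p. w \<in> ?I \<Longrightarrow> p < n \<Longrightarrow> col w p < ?D"
    "\<And>w p q. w \<in> ?I \<Longrightarrow> p < n \<Longrightarrow> q < n \<Longrightarrow> descends t w p q \<Longrightarrow> col w p \<noteq> col w q"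
    by blast+
  define pos where "pos w = inv_into {..<n} ((!) w)" for w :: "nat list"
  define lab where "lab w = (\<lambda>i\<in>{..<n}. (cell (map t w) (pos w i), col w (pos w i)))" for w
  \<comment> \<open>The first two components determine the label of every position, the third gives
    that of every letter. The colour occurs in both, whence the square of
    \<open>dA + dB\<close>.\<close>
  define code where "code w = (map t w, map (col w) [0..<n], lab w)" for w
  have w: "w \<in> permutations_of_set {..<n}" "length w = n" "distinct w" "set w = {..<n}" if "w \<in> ?I" for w
    using that by (auto simp: irreducibles_def length_finite_permutations_of_set permutations_of_setD)
  have pos: "pos w (w ! p) = p" if "w \<in> ?I" "p < n" for w p
    unfolding pos_def using w[OF that(1)] that(2) by (intro inv_into_f_f inj_on_nth) auto
  have wn: "w ! p < n" if "w \<in> ?I" "p < n" for w p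
    using w[OF that(1)] that(2) nth_mem by blast
  have pos_less: "pos w i < n" "w ! pos w i = i" if v: "w \<in> ?I" and i: "i < n" for w i
  proof -
    obtain p where "p < n" "w ! p = i" using w[OF v] i by (metis in_set_conv_nth lessThan_iff)
    then show "pos w i < n" "w ! pos w i = i" using pos[OF v] by auto
  qed
  have lab: "lab w (w ! p) = (cell (map t w) p, col w p)" if "w \<in> ?I" "p < n" for w p
    using wn[OF that] pos[OF that] by (simp add: lab_def)
  have "inj_on code ?I"
  proof (rule inj_onI)
    fix v w assume vw: "v \<in> ?I" "w \<in> ?I" "code v = code w"
    then have ts: "map t v = map t w" and cols: "map (col v) [0..<n] = map (col w) [0..<n]" and labs: "lab v = lab w"
      by (simp_all add: code_def)
    have col_eq: "col v p = col w p" if "p < n" for p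
      using arg_cong[OF cols, of "\<lambda>l. l ! p"] that by simp
    have key_eq: "(map t v ! p, lab v (v ! p)) = (map t w ! p, lab w (w ! p))" if "p < n" for p
      using ts col_eq[OF that] lab[OF vw(1) that] lab[OF vw(2) that] by simp
    \<comment> \<open>Positions with equal labels have the same key and the same colour, so they
      cannot descend.\<close>
    have incr: "u ! p < u ! q"
      if u: "u \<in> ?I" and "p < q" "q < n"
        and eq: "(map t u ! p, lab u (u ! p)) = (map t u ! q, lab u (u ! q))" for u p q
    proof -
      have "p < n" using that by simp
      have "\<not> descends t u p q"
        using col(2)[OF u \<open>p < n\<close> \<open>q < n\<close>] eq lab[OF u \<open>p < n\<close>] lab[OF u \<open>q < n\<close>] by auto
      moreover have "key (map t u) p = key (map t u) q"
        using eq lab[OF u \<open>p < n\<close>] lab[OF u \<open>q < n\<close>] by (simp add: key_def)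
      moreover have "u ! p \<noteq> u ! q"
        using w[OF u] \<open>p < q\<close> \<open>q < n\<close> by (simp add: nth_eq_iff_index_eq)
      ultimately show ?thesis using \<open>p < q\<close> by (simp add: descends_def)
    qed
    show "v = w"
    proof (rule list_eq_if_increasing_on_fibres[where lab = "\<lambda>i. (t i, lab v i)"
          and key = "\<lambda>p. (map t v ! p, lab v (v ! p))"])
      fix p q assume "p < q" "q < length v"
        "(map t v ! p, lab v (v ! p)) = (map t v ! q, lab v (v ! q))"
      then show "v ! p < v ! q" using incr[OF vw(1)] w[OF vw(1)] by simp
    next
      fix p q assume pq: "p < q" "q < length w"
        "(map t v ! p, lab v (v ! p)) = (map t v ! q, lab v (v ! q))"
      then have "q < n" "p < n" using w[OF vw(2)] by simp_all
      then show "w ! p < w ! q"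
        using incr[OF vw(2) pq(1) \<open>q < n\<close>] pq(3) key_eq[OF \<open>p < n\<close>] key_eq[OF \<open>q < n\<close>] by simp
    next
      fix p assume "p < length v"
      then show "(t (v ! p), lab v (v ! p)) = (map t v ! p, lab v (v ! p))" by simp
    next
      fix p assume p: "p < length w"
      then have "p < n" using w[OF vw(2)] by simp
      then show "(t (w ! p), lab v (w ! p)) = (map t v ! p, lab v (v ! p))"
        using key_eq[of p] labs p by simp
    qed (use w[OF vw(1)] w[OF vw(2)] in auto)
  qed
  moreover let ?B = "{xs. set xs \<subseteq> T \<and> length xs = n} \<times> {xs. set xs \<subseteq> {..<?D} \<and> length xs = n} \<times>
      (\<Pi>\<^sub>E i\<in>{..<n}. {..<cell_bound n t (t i)} \<times> {..<?D})"
  have "code ` ?I \<subseteq> ?B"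
  proof (rule image_subsetI)
    fix v assume v: "v \<in> ?I"
    have "lab v \<in> (\<Pi>\<^sub>E i\<in>{..<n}. {..<cell_bound n t (t i)} \<times> {..<?D})"
    proof (rule PiE_I)
      fix i assume "i \<in> {..<n}"
      then have i: "i < n" by simp
      show "lab v i \<in> {..<cell_bound n t (t i)} \<times> {..<?D}"
        using cell_less_bound[OF w(1)[OF v] pos_less(1)[OF v i], of t] pos_less[OF v i]
          col(1)[OF v pos_less(1)[OF v i]] i by (simp add: lab_def)
    qed (simp add: lab_def)
    then show "code v \<in> ?B" using w[OF v] T(2) col(1)[OF v] by (auto simp: code_def)
  qed
  moreover have "finite ?B"
    using T(1) by (intro finite_cartesian_product finite_lists_length_eq finite_PiE) auto
  ultimately have "card ?I \<le> card ?B" by (rule card_inj_on_le)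
  also have "\<dots> = card T ^ n * (?D ^ n * (\<Prod>i<n. cell_bound n t (t i) * ?D))"
    using T(1) by (simp add: card_cartesian_product card_lists_length_eq card_PiE)
  also have "\<dots> = (card T * ?D ^ 2) ^ n * (\<Prod>i<n. cell_bound n t (t i))"
    by (simp add: prod.distrib power_mult_distrib power2_eq_square)
  also have "\<dots> \<le> (card T * ?D ^ 2) ^ n * (Suc k ^ n *
      (Suc (elts_in n t) ^ As_in n t * Suc (As_in n t + elts_in n t) ^ Bs_in n t))"
  proof (rule mult_le_mono2)
    have "As_in n t \<le> n" using letter_counts_sum[of n t] by simp
    then have "Suc k ^ As_in n t \<le> Suc k ^ n" by (intro power_increasing) auto
    then show "(\<Prod>i<n. cell_bound n t (t i)) \<le> Suc k ^ n *
        (Suc (elts_in n t) ^ As_in n t * Suc (As_in n t + elts_in n t) ^ Bs_in n t)"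
      unfolding prod_cell_bound power_mult_distrib
      by (metis mult.assoc mult.commute mult_le_mono1)
  qed
  finally show ?thesis by (simp only: power_mult_distrib mult.assoc)
qed

section \<open>Existence of an identity for the whole algebra\<close>

lemma vanishing_from_spanning_set:
  fixes n :: nat
  assumes van: "\<And>y. \<forall>i<n. y i \<in> A \<union> B \<union> E \<Longrightarrow>
      (\<Sum>w\<in>permutations_of_set {..<n}. c w *s prd (map y w)) = 0"
  shows "(\<Sum>w\<in>permutations_of_set {..<n}. c w *s prd (map y w)) = 0"
proof -
  define \<Phi> where "\<Phi> y = (\<Sum>w\<in>permutations_of_set {..<n}. c w *s prd (map y w))" for y
  \<comment> \<open>Multilinearity frees one variable at a time: the first \<open>j\<close>
    variables are arbitrary, the others still lie in the spanning set.\<close>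
  have "\<forall>y. (\<forall>i. j \<le> i \<and> i < n \<longrightarrow> y i \<in> A \<union> B \<union> E) \<longrightarrow> \<Phi> y = 0" if "j \<le> n" for j
    using that
  proof (induction j)
    case 0
    then show ?case using van by (simp add: \<Phi>_def)
  next
    case (Suc j)
    show ?case
    proof (intro allI impI)
      fix y :: "nat \<Rightarrow> 'a" assume y: "\<forall>i. Suc j \<le> i \<and> i < n \<longrightarrow> y i \<in> A \<union> B \<union> E"
      have prd_linear:
        "prd (map (y(j := x + z)) w) = prd (map (y(j := x)) w) + prd (map (y(j := z)) w)"
        "prd (map (y(j := r *s x)) w) = r *s prd (map (y(j := x)) w)"
        if w: "w \<in> permutations_of_set {..<n}" for w x z r
      proof -
        have "j \<in> set w" using w Suc.prems by (simp add: permutations_of_setD)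
        then obtain us vs where "w = us @ j # vs" by (metis split_list)
        moreover from this have "j \<notin> set us" "j \<notin> set vs" using w by (auto dest: permutations_of_setD)
        ultimately show
          "prd (map (y(j := x + z)) w) = prd (map (y(j := x)) w) + prd (map (y(j := z)) w)"
          "prd (map (y(j := r *s x)) w) = r *s prd (map (y(j := x)) w)"
          using prd_slot_add[of "map y us" x z "map y vs"] prd_slot_scale[of "map y us" r x "map y vs"]
          by simp_all
      qed
      have add: "\<Phi> (y(j := x + z)) = \<Phi> (y(j := x)) + \<Phi> (y(j := z))" for x z
        unfolding \<Phi>_def sum.distrib[symmetric]
        by (intro sum.cong refl) (simp only: prd_linear scale_right_distrib)
      have scale: "\<Phi> (y(j := r *s x)) = r *s \<Phi> (y(j := x))" for r x
        unfolding \<Phi>_def scale_sum_right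
        by (intro sum.cong refl) (simp only: prd_linear scale_left_commute)
      have "subspace {x. \<Phi> (y(j := x)) = 0}"
        using scale[of 0 0] by (intro subspaceI) (simp_all add: add scale)
      moreover have "\<Phi> (y(j := x)) = 0" if "x \<in> A \<union> B \<union> E" for x
      proof -
        have "\<forall>i. j \<le> i \<and> i < n \<longrightarrow> (y(j := x)) i \<in> A \<union> B \<union> E"
          using y that by (auto simp: Suc_le_eq)
        then show ?thesis using Suc.IH Suc.prems by simp
      qed
      ultimately have "span (A \<union> B \<union> E) \<subseteq> {x. \<Phi> (y(j := x)) = 0}"
        by (intro span_minimal) auto
      then have "\<Phi> (y(j := y j)) = 0" unfolding spanning by blast
      then show "\<Phi> y = 0" by simp
    qed
  qed
  then have "(\<forall>i. n \<le> i \<and> i < n \<longrightarrow> y i \<in> A \<union> B \<union> E) \<longrightarrow> \<Phi> y = 0" by blast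
  then show ?thesis by (auto simp: \<Phi>_def)
qed

theorem satisfies_identity_UNIV: "satisfies_identity UNIV"
proof -
  define T where "T = {InA, InB} \<union> Elt ` E"
  have "finite T" using finE by (simp add: T_def)
  have "card T > 0" using \<open>finite T\<close> by (auto simp: T_def card_gt_0_iff)
  \<comment> \<open>The first factor \<open>card T\<close> accounts for the number of type
    assignments, the rest comes from \<open>card_irreducibles_le\<close>.\<close>
  define C where "C = card T * (card T * (dA + dB) ^ 2 * Suc k)"
  obtain n where n: "\<And>s a b. s + a + b = n \<Longrightarrow> C ^ n * (Suc s ^ a * Suc (a + s) ^ b) < fact n"
    using label_count_less_fact by blast
  \<comment> \<open>For \<open>n = 0\<close> the strict bound would read
    \<open>1 < 1\<close>.\<close>
  have "n > 0" using n[of 0 0 0] by (cases n) auto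
  let ?W = "permutations_of_set {..<n}"
  define \<T> where "\<T> = ({..<n} \<rightarrow>\<^sub>E T)"
  have fin\<T>: "finite \<T>" "card \<T> = card T ^ n"
    using \<open>finite T\<close> by (simp_all add: \<T>_def finite_PiE card_PiE)
  have finI: "finite (irreducibles n t)" for t by (simp add: irreducibles_def)
  let ?E = "SIGMA t:\<T>. irreducibles n t"
  have "card T ^ n * card (irreducibles n t) < fact n" if "t \<in> \<T>" for t
  proof -
    have "t i \<in> T" if "i < n" for i using \<open>t \<in> \<T>\<close> that by (auto simp: \<T>_def)
    from card_irreducibles_le[OF \<open>finite T\<close> this]
    have "card T ^ n * card (irreducibles n t) \<le> C ^ n *
        (Suc (elts_in n t) ^ As_in n t * Suc (As_in n t + elts_in n t) ^ Bs_in n t)"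
      unfolding C_def power_mult_distrib[of "card T" "card T * _ * _"] mult.assoc[of "card T ^ n"]
      by (rule mult_le_mono2)
    also have "\<dots> < fact n" by (rule n) (rule letter_counts_sum)
    finally show ?thesis .
  qed
  then have "(\<Sum>t\<in>\<T>. card T ^ n * card (irreducibles n t)) < (\<Sum>t\<in>\<T>. fact n)"
    using fin\<T> \<open>card T > 0\<close> by (intro sum_strict_mono) (auto simp: card_gt_0_iff)
  then have "card T ^ n * card ?E < card T ^ n * fact n"
    using fin\<T> finI by (simp add: sum_distrib_left[symmetric])
  then have small: "card ?E < card ?W" by simp
  define \<rho> where "\<rho> t w = (SOME r. \<forall>y. fits n t y \<longrightarrow>
      prd (map y w) = (\<Sum>u\<in>irreducibles n t. r u *s prd (map y u)))" for t w
  have \<rho>: "prd (map y w) = (\<Sum>u\<in>irreducibles n t. \<rho> t w u *s prd (map y u))"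
    if "w \<in> ?W" "fits n t y" for t w y
    using someI_ex[OF irreducibles_span[OF that(1), of t]] that(2) unfolding \<rho>_def by blast
  \<comment> \<open>There is one equation for each type assignment and irreducible word
    \<open>u\<close>: the coefficient of \<open>u\<close> in the rewritten sum vanishes.\<close>
  obtain c where c: "\<exists>w\<in>?W. c w \<noteq> 0"
    "\<forall>e\<in>?E. (\<Sum>w\<in>?W. c w * \<rho> (fst e) w (snd e)) = 0"
    using underdetermined_system[OF _ finite_permutations_of_set small,
        of "\<lambda>e w. \<rho> (fst e) w (snd e)"] finite_SigmaI[OF fin\<T>(1) finI]
    by iprover
  have van: "(\<Sum>w\<in>?W. c w *s prd (map y w)) = 0" if y: "\<forall>i<n. y i \<in> A \<union> B \<union> E" for y
  proof -
    \<comment> \<open>A value lying in several of the sets gets the first matching type; restricting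
      \<open>t\<close> to \<open>{..<n}\<close> puts it into the finite function space
      \<open>\<T>\<close>.\<close>
    define t where "t = (\<lambda>i\<in>{..<n}. if y i \<in> A then InA else if y i \<in> B then InB else Elt (y i))"
    have "t \<in> \<T>" using y unfolding t_def \<T>_def restrict_PiE_iff by (auto simp: T_def)
    have "fits n t y" by (auto simp: fits_def t_def)
    have "(\<Sum>w\<in>?W. c w *s prd (map y w)) =
        (\<Sum>w\<in>?W. \<Sum>u\<in>irreducibles n t. (c w * \<rho> t w u) *s prd (map y u))"
      by (intro sum.cong refl) (simp add: \<rho>[OF _ \<open>fits n t y\<close>] scale_sum_right)
    also have "\<dots> = (\<Sum>u\<in>irreducibles n t. (\<Sum>w\<in>?W. c w * \<rho> t w u) *s prd (map y u))"
      by (subst sum.swap) (simp add: scale_sum_left)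
    also have "\<dots> = 0"
      using c(2) \<open>t \<in> \<T>\<close> by (intro sum.neutral) force
    finally show ?thesis .
  qed
  \<comment> \<open>Zero coefficients are dropped because \<open>satisfies_identity\<close> demands
    non-zero ones on the support.\<close>
  let ?K = "{w\<in>?W. c w \<noteq> 0}"
  have "(\<Sum>w\<in>?K. c w *s prd (map y w)) = 0" for y
  proof -
    have "(\<Sum>w\<in>?K. c w *s prd (map y w)) = (\<Sum>w\<in>?W. c w *s prd (map y w))"
      by (rule sum.mono_neutral_left) auto
    also have "\<dots> = 0" by (rule vanishing_from_spanning_set[OF van])
    finally show ?thesis .
  qed
  moreover have "[] \<notin> ?K" using \<open>n > 0\<close> by (auto simp: permutations_of_set_def)
  moreover have "finite ?K" "?K \<noteq> {}" using c(1) by auto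
  ultimately show ?thesis unfolding satisfies_identity_def
    by (intro exI[of _ ?K] exI[of _ c]) simp
qed

end

section \<open>Almost sums and the opposite algebra\<close>

context bilinear_algebra
begin

lemma satisfies_identity_of_almost_sum:
  assumes "subspace A" "subspace B" "mult_closed A" "mult_closed B"
    and "satisfies_identity A" "satisfies_identity B"
    and "finite E" "span (A \<union> B \<union> E) = UNIV" "alternating m A B k \<subseteq> A"
  shows "satisfies_identity UNIV"
proof -
  obtain dA cA where "multilinear_identity dA cA A"
    using multilinear_identity_exists assms by blast
  moreover obtain dB cB where "multilinear_identity dB cB B"
    using multilinear_identity_exists assms by blast
  ultimately interpret almost_sum scale m A B E k dA dB cA cB
    using assms by unfold_locales
  show ?thesis by (rule satisfies_identity_UNIV)
qed

lemma mprod_opposite: "xs \<noteq> [] \<Longrightarrow> mprod (\<lambda>x y. y \<star> x) xs = prd (rev xs)"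
proof (induction xs rule: rev_induct)
  case (snoc x xs)
  show ?case
  proof (cases "xs = []")
    case False
    then have "mprod (\<lambda>x y. y \<star> x) (xs @ [x]) = x \<star> mprod (\<lambda>x y. y \<star> x) xs"
      by (cases xs) auto
    then show ?thesis using snoc False by (simp add: prd_Cons del: mprod.simps)
  qed simp
qed simp

lemma bilinear_algebra_opposite: "bilinear_algebra scale (\<lambda>x y. y \<star> x)"
  by unfold_locales (simp_all add: assoc add_left add_right scale_left scale_right)

text \<open>Reversing the words of the identity compensates for the reversed multiplication.\<close>

lemma satisfies_identity_opposite:
  assumes "satisfies_identity S"
  shows "bilinear_algebra.satisfies_identity scale (\<lambda>x y. y \<star> x) S"
proof -
  obtain K f where K: "finite K" "K \<noteq> {}" "[] \<notin> K" "\<forall>w\<in>K. f w \<noteq> 0"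
    "\<And>a :: nat \<Rightarrow> 'a. range a \<subseteq> S \<Longrightarrow> (\<Sum>w\<in>K. f w *s prd (map a w)) = 0"
    using assms unfolding satisfies_identity_def by blast
  have "(\<Sum>w\<in>rev ` K. f (rev w) *s mprod (\<lambda>x y. y \<star> x) (map a w)) = 0" if "range a \<subseteq> S" for a :: "nat \<Rightarrow> 'a"
  proof -
    have "(\<Sum>w\<in>rev ` K. f (rev w) *s mprod (\<lambda>x y. y \<star> x) (map a w)) =
        (\<Sum>w\<in>K. f w *s mprod (\<lambda>x y. y \<star> x) (rev (map a w)))"
      by (subst sum.reindex) (auto simp: inj_on_def rev_map)
    also have "\<dots> = (\<Sum>w\<in>K. f w *s prd (map a w))"
      using K(3) by (intro sum.cong refl) (metis mprod_opposite map_is_Nil_conv rev_is_Nil_conv rev_rev_ident)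
    finally show ?thesis using K(5)[OF that] by simp
  qed
  then show ?thesis
    unfolding bilinear_algebra.satisfies_identity_def[OF bilinear_algebra_opposite]
    using K(1-4) by (intro exI[of _ "rev ` K"] exI[of _ "\<lambda>w. f (rev w)"]) auto
qed

end

subsection \<open>PI-algebras\<close>

lemma list_product_eq_mprod: "xs \<noteq> [] \<Longrightarrow> list_product xs = mprod (*) xs"
  by (cases xs) simp_all

lemma list_product_snoc: "xs \<noteq> [] \<Longrightarrow> list_product (xs @ [x]) = list_product xs * x"
  by (cases xs) simp_all

lemma list_product_Cons: "xs \<noteq> [] \<Longrightarrow> list_product (x # xs) = x * list_product xs"
proof (induction xs rule: rev_induct)
  case (snoc y xs)
  then show ?case
    by (cases "xs = []") (simp_all add: list_product_snoc[of "x # xs" y, simplified] list_product_snoc mult.assoc)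
qed simp

lemma alternating_productsI:
  "x = list_product (map2 (*) as bs) \<Longrightarrow> length as = k \<Longrightarrow> length bs = k \<Longrightarrow>
    set as \<subseteq> A \<Longrightarrow> set bs \<subseteq> B \<Longrightarrow> x \<in> alternating_products A B k"
  unfolding alternating_products_def by blast

lemma alternating_subset_products:
  "alternating (*) A B c \<subseteq> alternating_products A B (Suc c)"
proof (induction c)
  case 0
  show ?case
  proof
    fix x assume "x \<in> alternating (*) A B 0"
    then obtain a b where "a \<in> A" "b \<in> B" "x = a * b" by auto
    then show "x \<in> alternating_products A B (Suc 0)"
      by (intro alternating_productsI[of _ "[a]" "[b]"]) simp_all
  qed
next
  case (Suc c)
  show ?case
  proof
    fix x assume "x \<in> alternating (*) A B (Suc c)"
    then obtain x' a b where x: "x' \<in> alternating (*) A B c" "a \<in> A" "b \<in> B" "x = x' * (a * b)"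
      by auto
    with Suc obtain as bs where "x' = list_product (map2 (*) as bs)" "length as = Suc c" "length bs = Suc c"
      "set as \<subseteq> A" "set bs \<subseteq> B"
      unfolding alternating_products_def by blast
    moreover from this have "map2 (*) as bs \<noteq> []" by auto
    ultimately show "x \<in> alternating_products A B (Suc (Suc c))"
      using x by (intro alternating_productsI[of _ "as @ [a]" "bs @ [b]"])
        (auto simp: list_product_snoc)
  qed
qed

text \<open>In the opposite algebra \<open>b\<close> times \<open>a\<close> is \<open>a * b\<close>,
  and new pairs are attached on the left. So \<open>(BA)^(c+1)\<close> formed there lies in
  \<open>(AB)^(c+1)\<close>, which turns the second case of the theorem into the first.\<close>

lemma alternating_opposite_subset_products:
  fixes A B :: "'a::semigroup_mult set"
  shows "alternating (\<lambda>x y. y * x) B A c \<subseteq> alternating_products A B (Suc c)"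
proof (induction c)
  case 0
  show ?case
  proof
    fix x assume "x \<in> alternating (\<lambda>x y. y * x) B A 0"
    then obtain a b where "a \<in> A" "b \<in> B" "x = a * b" by auto
    then show "x \<in> alternating_products A B (Suc 0)"
      by (intro alternating_productsI[of _ "[a]" "[b]"]) simp_all
  qed
next
  case (Suc c)
  show ?case
  proof
    fix x assume "x \<in> alternating (\<lambda>x y. y * x) B A (Suc c)"
    then obtain x' a b where x: "x' \<in> alternating (\<lambda>x y. y * x) B A c" "a \<in> A" "b \<in> B" "x = (a * b) * x'"
      by auto
    with Suc obtain as bs where "x' = list_product (map2 (*) as bs)" "length as = Suc c" "length bs = Suc c"
      "set as \<subseteq> A" "set bs \<subseteq> B"
      unfolding alternating_products_def by blast
    moreover from this have "map2 (*) as bs \<noteq> []" by auto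
    ultimately show "x \<in> alternating_products A B (Suc (Suc c))"
      using x by (intro alternating_productsI[of _ "a # as" "b # bs"])
        (auto simp: list_product_Cons simp del: list_product.simps)
  qed
qed

section \<open>Transfer to the notions of the theorem\<close>

context assoc_algebra
begin

sublocale bilinear_algebra scale "(*)"
  by unfold_locales (simp_all add: mult.assoc distrib_right distrib_left scale_mult_left scale_mult_right)

lemma satisfies_identity_if_PI:
  assumes "PI_algebra S" "I \<subseteq> S"
  shows "satisfies_identity I"
proof -
  obtain f where f: "f \<in> free_algebra" "f \<noteq> 0" "\<And>a. \<forall>i. a i \<in> S \<Longrightarrow> eval_poly a f = 0"
    using assms(1) unfolding PI_algebra_def polynomial_identity_def by blast
  let ?K = "Poly_Mapping.keys f"
  have "[] \<notin> ?K" using f(1) by (simp add: free_algebra_def)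
  have "(\<Sum>w\<in>?K. Poly_Mapping.lookup f w *s mprod (*) (map a w)) = 0" if "range a \<subseteq> I" for a :: "nat \<Rightarrow> 'a"
  proof -
    have "(\<Sum>w\<in>?K. Poly_Mapping.lookup f w *s mprod (*) (map a w)) = eval_poly a f"
      unfolding eval_poly_def using \<open>[] \<notin> ?K\<close>
      by (intro sum.cong refl) (metis list_product_eq_mprod map_is_Nil_conv)
    then show ?thesis using f(3)[of a] that assms(2) by auto
  qed
  then show ?thesis unfolding satisfies_identity_def
    using f(2) \<open>[] \<notin> ?K\<close>
    by (intro exI[of _ ?K] exI[of _ "Poly_Mapping.lookup f"]) (simp add: in_keys_iff)
qed

lemma PI_if_satisfies_identity:
  assumes "satisfies_identity S"
  shows "PI_algebra S"
proof -
  obtain K f where K: "finite K" "K \<noteq> {}" "[] \<notin> K" "\<forall>w\<in>K. f w \<noteq> 0"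
    "\<And>a :: nat \<Rightarrow> 'a. range a \<subseteq> S \<Longrightarrow> (\<Sum>w\<in>K. f w *s mprod (*) (map a w)) = 0"
    using assms unfolding satisfies_identity_def by blast
  define p where "p = Abs_poly_mapping (\<lambda>w. if w \<in> K then f w else 0)"
  have lookup: "Poly_Mapping.lookup p w = (if w \<in> K then f w else 0)" for w
    unfolding p_def using K(1) by (subst lookup_Abs_poly_mapping) (auto intro: finite_subset)
  have keys: "Poly_Mapping.keys p = K"
    using K(4) by (auto simp: in_keys_iff lookup split: if_splits)
  have "eval_poly a p = 0" if "\<forall>i. a i \<in> S" for a
  proof -
    have "eval_poly a p = (\<Sum>w\<in>K. f w *s mprod (*) (map a w))"
      unfolding eval_poly_def keys using K(3)
      by (intro sum.cong refl) (metis list_product_eq_mprod lookup map_is_Nil_conv)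
    then show ?thesis using K(5)[of a] that by auto
  qed
  moreover have "p \<noteq> 0" using K(2) keys by auto
  ultimately show ?thesis
    unfolding PI_algebra_def polynomial_identity_def free_algebra_def using K(3) keys by blast
qed

lemma finite_codim_sum_spanning:
  assumes sum: "\<forall>r. \<exists>r1\<in>R1. \<exists>r2\<in>R2. r = r1 + r2"
    and "finite_codim I1 R1" "finite_codim I2 R2"
  obtains E where "finite E" "span (I1 \<union> I2 \<union> E) = UNIV"
proof -
  obtain B1 where B1: "finite B1" "\<And>s. s \<in> R1 \<Longrightarrow> \<exists>b\<in>span B1. s - b \<in> I1"
    using assms(2) unfolding finite_codim_def by blast
  obtain B2 where B2: "finite B2" "\<And>s. s \<in> R2 \<Longrightarrow> \<exists>b\<in>span B2. s - b \<in> I2"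
    using assms(3) unfolding finite_codim_def by blast
  let ?S = "span (I1 \<union> I2 \<union> (B1 \<union> B2))"
  have mem: "s \<in> ?S" if "b \<in> span C" "s - b \<in> I" "C \<subseteq> B1 \<union> B2" "I \<subseteq> I1 \<union> I2" for s b C I
  proof -
    have "b \<in> ?S" using that(1,3) span_mono[of C "I1 \<union> I2 \<union> (B1 \<union> B2)"] by blast
    moreover have "s - b \<in> ?S" using that(2,4) by (intro span_base) blast
    ultimately show ?thesis using span_add[of "s - b" _ b] by simp
  qed
  have "r \<in> ?S" for r
  proof -
    obtain r1 r2 where "r1 \<in> R1" "r2 \<in> R2" "r = r1 + r2" using sum by blast
    then show ?thesis using B1(2) B2(2) mem[of _ B1 _ I1] mem[of _ B2 _ I2] span_add by blast
  qed
  then show ?thesis using that[of "B1 \<union> B2"] B1(1) B2(1) by auto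
qed

lemma PI_algebra_of_almost_sum:
  assumes "\<forall>r. \<exists>r1\<in>R1. \<exists>r2\<in>R2. r = r1 + r2"
    and "PI_algebra R1" "PI_algebra R2"
    and I1: "two_sided_ideal I1 R1" "finite_codim I1 R1"
    and I2: "two_sided_ideal I2 R2" "finite_codim I2 R2"
    and "k > 0"
    and alt: "alternating_products I1 I2 k \<subseteq> I1 \<or> alternating_products I1 I2 k \<subseteq> I2"
  shows "PI_algebra UNIV"
proof (rule PI_if_satisfies_identity)
  obtain E where E: "finite E" "span (I1 \<union> I2 \<union> E) = UNIV"
    using finite_codim_sum_spanning assms by blast
  have sub: "subspace I1" "subspace I2" and mult: "mult_closed I1" "mult_closed I2"
    and ids: "satisfies_identity I1" "satisfies_identity I2"
    using I1(1) I2(1) assms(2,3) satisfies_identity_if_PI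
    by (auto simp: two_sided_ideal_def mult_closed_def)
  obtain c where k: "k = Suc c" using \<open>k > 0\<close> gr0_conv_Suc by blast
  from alt show "satisfies_identity UNIV"
  proof
    assume "alternating_products I1 I2 k \<subseteq> I1"
    then have "alternating (*) I1 I2 c \<subseteq> I1" using alternating_subset_products k by blast
    then show ?thesis using satisfies_identity_of_almost_sum[OF sub mult ids E] by blast
  next
    assume "alternating_products I1 I2 k \<subseteq> I2"
    then have "alternating (\<lambda>x y. y * x) I2 I1 c \<subseteq> I2"
      using alternating_opposite_subset_products k by blast
    interpret op: bilinear_algebra scale "\<lambda>x y. y * x" by (rule bilinear_algebra_opposite)
    have "op.satisfies_identity UNIV"
    proof (rule op.satisfies_identity_of_almost_sum[of I2 I1 E c])
      show "op.mult_closed I2" "op.mult_closed I1"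
        using mult by (simp_all add: mult_closed_def op.mult_closed_def)
      show "op.satisfies_identity I2" "op.satisfies_identity I1"
        using ids satisfies_identity_opposite by blast+
    qed (use sub E \<open>alternating (\<lambda>x y. y * x) I2 I1 c \<subseteq> I2\<close> in \<open>auto simp: Un_commute\<close>)
    \<comment> \<open>The opposite of the opposite multiplication is the given one.\<close>
    then show ?thesis by (rule op.satisfies_identity_opposite)
  qed
qed

end

theorem corollary2p2:
  fixes scale :: "'f::field \<Rightarrow> 'a::ring \<Rightarrow> 'a"
    and R1 R2 I1 I2 :: "'a set"
    and k :: nat
  assumes "CHAR('f) > 0"
    and "assoc_algebra scale"
    and "assoc_algebra.subalgebra scale R1"
    and "assoc_algebra.subalgebra scale R2"
    and "\<forall>r. \<exists>r1\<in>R1. \<exists>r2\<in>R2. r = r1 + r2"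
    and "assoc_algebra.PI_algebra scale R1"
    and "assoc_algebra.PI_algebra scale R2"
    and "assoc_algebra.two_sided_ideal scale I1 R1"
    and "assoc_algebra.finite_codim scale I1 R1"
    and "assoc_algebra.two_sided_ideal scale I2 R2"
    and "assoc_algebra.finite_codim scale I2 R2"
    and "k > 0"
    and "alternating_products I1 I2 k \<subseteq> I1 \<or> alternating_products I1 I2 k \<subseteq> I2"
  shows "assoc_algebra.PI_algebra scale UNIV"
  using assoc_algebra.PI_algebra_of_almost_sum[OF assms(2,5-13)] .

end
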